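(* Let $\mathcal F$ be a saturated FDFA using any of the acceptance types exact, normalized, or duo-normalized, and let $k$ be a positive integer. Then: (1) $[\![\mathcal F]\!]\in\mathbb{DM}_k^{\pm}$ iff $|\mathcal F|_{\leadsto}^{+}\le k$ and $|\mathcal F|_{\leadsto}^{-}\le k$; (2) $[\![\mathcal F]\!]\in\mathbb{DM}_k^{+}$ iff $|\mathcal F|_{\leadsto}^{+}\le k$ and $|\mathcal F|_{\leadsto}^{-}<k$; (3) $[\![\mathcal F]\!]\in\mathbb{DM}_k^{-}$ iff $|\mathcal F|_{\leadsto}^{+}<k$ and $|\mathcal F|_{\leadsto}^{-}\le k$.
   Context: $\Sigma$ is a finite alphabet. For a (complete deterministic) automaton $\mathcal A$ and $w\in\Sigma^*$, $\mathcal A(w)$ is the state reached from the initial state on reading $w$; $[\![\mathcal D]\!]$ is the language of a DFA $\mathcal D$. FDFAs. An FDFA is a pair $\mathcal F=(\mathcal Q,\{\mathcal P_q\}_{q\in Q})$ of a leading automaton structure $\mathcal Q$ (a complete deterministic automaton without acceptance, with state set $Q$) and a complete progress DFA $\mathcal P_q$ for each $q\in Q$; write $\mathcal P_u=\mathcal P_{\mathcal Q(u)}$ for $u\in\Sigma^*$. For $u\in\Sigma^*,v\in\Sigma^+$: $(u,v)$ is a decomposition of $w$ if $uv^\omega=w$; normalized if $\mathcal Q(uv)=\mathcal Q(u)$; duo-normalized if normalized and $\mathcal P_u(vv)=\mathcal P_u(v)$. With exact acceptance, $(u,v)\in[\![\mathcal F]\!]$ iff $v\in[\![\mathcal P_u]\!]$;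 with normalized (resp. duo-normalized) acceptance, $(u,v)\in[\![\mathcal F]\!]$ iff there is a normalized (resp. duo-normalized) decomposition $(x,y)$ of $uv^\omega$ with $y\in[\![\mathcal P_x]\!]$. $\mathcal F$ is saturated if, for every ultimately periodic word $w$, all decompositions $(x,y)$ of $w$ of the type used (all, normalized, duo-normalized, respectively) agree on whether $y\in[\![\mathcal P_x]\!]$. $[\![\mathcal F]\!]$ is identified with the unique $\omega$-regular language whose ultimately periodic words are the words $uv^\omega$ with $(u,v)\in[\![\mathcal F]\!]$. Diameter measure. $(u,v)$ is persistent (wrt $\mathcal F$) if it is duo-normalized and for every $z\in\Sigma^*$ there is $i\ge 2$ with $\mathcal P_u(zv)=\mathcal P_u(zv^i)$. With $\prec$ the strict prefix relation, $v_1\prec v_2\prec\dots\prec v_k$ is a persistent chain of length $k$ wrt $u$ in $\mathcal F$ if $(u,v_i)$ is persistent for all $1\le i\le k$ and $(u,v_{i+1})\in[\![\mathcal F]\!]$ iff $(u,v_i)\notin[\![\mathcal F]\!]$ for all $1\le i<k$; it is positive if $(u,v_1)\in[\![\mathcal F]\!]$ and negative otherwise. $|\mathcal F|_{\leadsto}^{+}$ (resp. $|\mathcal F|_{\leadsto}^{-}$) is the maximal $k$ such that there are $u\in\Sigma^*$ and a positive (resp. negative) persistent chain of length $k$ wrt $u$ in $\mathcal F$ ($0$ if there is none). Wagner hierarchy. A DMA is a complete deterministic Muller automaton $\mathcal M$ with acceptance $\alpha\subseteq 2^{Q}$ (a run is accepting iff the set of states visited infinitely often is in $\alpha$). An SCC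 is a nonempty set $S$ of states, not necessarily maximal, such that there is a path within $S$ between every pair of its states (a singleton must have a self-loop); it is accepting if $S\in\alpha$, otherwise rejecting. $|\mathcal M|_{\subseteq}^{+}$ (resp. $|\mathcal M|_{\subseteq}^{-}$) is the maximal length $k$ of a strict inclusion chain $S_1\subset S_2\subset\dots\subset S_k$ of (reachable) SCCs of alternating acceptance with $S_1$ accepting (resp. rejecting). $\mathbb{DM}_k^{+}$ (resp. $\mathbb{DM}_k^{-}$, $\mathbb{DM}_k^{\pm}$) is the class of languages recognized by some DMA $\mathcal M$ with $|\mathcal M|_{\subseteq}^{+}\le k$ and $|\mathcal M|_{\subseteq}^{-}<k$ (resp. $|\mathcal M|_{\subseteq}^{+}<k$ and $|\mathcal M|_{\subseteq}^{-}\le k$; $|\mathcal M|_{\subseteq}^{+}\le k$ and $|\mathcal M|_{\subseteq}^{-}\le k$). *)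

theory Defs
  imports "HOL-Library.Sublist" "HOL-Library.Omega_Words_Fun" "HOL-Library.Extended_Nat"
begin

section \<open>Complete deterministic automata\<close>

text \<open>
  The alphabet is a type (finite in the theorem). State spaces are explicit finite carrier sets, so
  that automata of different sizes share a type. The omega-words, the operations
  \<open>u \<frown> w\<close> and \<open>v\<^sup>\<omega>\<close>, and \<open>limit\<close> (the values occurring infinitely often) are those of
  \<^theory>\<open>HOL-Library.Omega_Words_Fun\<close>.
\<close>

record ('a, 'q) dts =
  states :: "'q set"
  start :: 'q
  step :: "'q \<Rightarrow> 'a \<Rightarrow> 'q"

record ('a, 'q) dfa = "('a, 'q) dts" +
  final :: "'q set"

record ('a, 'q) dma = "('a, 'q) dts" +
  table :: "'q set set"

definition wf_dts :: "('a, 'q, 'z) dts_scheme \<Rightarrow> bool" where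
  "wf_dts A \<longleftrightarrow> finite (states A) \<and> start A \<in> states A
     \<and> (\<forall>q \<in> states A. \<forall>a. step A q a \<in> states A)"

definition reach :: "('a, 'q, 'z) dts_scheme \<Rightarrow> 'a list \<Rightarrow> 'q" where
  "reach A w = foldl (step A) (start A) w"

definition wf_dfa :: "('a, 'q) dfa \<Rightarrow> bool" where
  "wf_dfa D \<longleftrightarrow> wf_dts D \<and> final D \<subseteq> states D"

definition dfa_lang :: "('a, 'q) dfa \<Rightarrow> 'a list set" where
  "dfa_lang D = {w. reach D w \<in> final D}"


section \<open>Muller automata and the Wagner hierarchy\<close>

definition wf_dma :: "('a, 'q) dma \<Rightarrow> bool" where
  "wf_dma M \<longleftrightarrow> wf_dts M \<and> table M \<subseteq> Pow (states M)"

definition run :: "('a, 'q, 'z) dts_scheme \<Rightarrow> 'a word \<Rightarrow> 'q word" where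
  "run A w = (\<lambda>n. reach A (map w [0..<n]))"

definition dma_lang :: "('a, 'q) dma \<Rightarrow> 'a word set" where
  "dma_lang M = {w. limit (run M w) \<in> table M}"

text \<open>
  The transitive (not reflexive) closure forces a singleton to carry a self-loop.
\<close>

definition scc :: "('a, 'q, 'z) dts_scheme \<Rightarrow> 'q set \<Rightarrow> bool" where
  "scc A S \<longleftrightarrow> S \<noteq> {} \<and> S \<subseteq> states A
     \<and> (\<forall>p \<in> S. \<forall>q \<in> S. (p, q) \<in> {(r, step A r a) | r a. r \<in> S \<and> step A r a \<in> S}\<^sup>+)"

definition reachable_scc :: "('a, 'q, 'z) dts_scheme \<Rightarrow> 'q set \<Rightarrow> bool" where
  "reachable_scc A S \<longleftrightarrow> scc A S \<and> S \<subseteq> range (reach A)"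

definition inclusion_chain :: "('a, 'q) dma \<Rightarrow> 'q set list \<Rightarrow> bool" where
  "inclusion_chain M Ss \<longleftrightarrow>
     (\<forall>S \<in> set Ss. reachable_scc M S)
   \<and> (\<forall>i. Suc i < length Ss \<longrightarrow>
        Ss ! i \<subset> Ss ! Suc i \<and> (Ss ! Suc i \<in> table M \<longleftrightarrow> Ss ! i \<notin> table M))"

text \<open>
  All maximal lengths are suprema in \<^typ>\<open>enat\<close>: the supremum of the empty set is 0, and the
  supremum of an unbounded set is \<open>\<infinity>\<close>.
\<close>

definition dma_pos :: "('a, 'q) dma \<Rightarrow> enat" where
  "dma_pos M = Sup {enat (length Ss) | Ss.
     Ss \<noteq> [] \<and> inclusion_chain M Ss \<and> hd Ss \<in> table M}"

definition dma_neg :: "('a, 'q) dma \<Rightarrow> enat" where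
  "dma_neg M = Sup {enat (length Ss) | Ss.
     Ss \<noteq> [] \<and> inclusion_chain M Ss \<and> hd Ss \<notin> table M}"

text \<open>
  Every finite automaton is isomorphic to one whose states are natural numbers, so letting
  the automata below range over state type \<^typ>\<open>nat\<close> is no restriction.
\<close>

definition DM_pos :: "nat \<Rightarrow> 'a word set set" where
  "DM_pos k = {dma_lang M | M :: ('a, nat) dma.
     wf_dma M \<and> dma_pos M \<le> enat k \<and> dma_neg M < enat k}"

definition DM_neg :: "nat \<Rightarrow> 'a word set set" where
  "DM_neg k = {dma_lang M | M :: ('a, nat) dma.
     wf_dma M \<and> dma_pos M < enat k \<and> dma_neg M \<le> enat k}"

definition DM_both :: "nat \<Rightarrow> 'a word set set" where
  "DM_both k = {dma_lang M | M :: ('a, nat) dma.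
     wf_dma M \<and> dma_pos M \<le> enat k \<and> dma_neg M \<le> enat k}"

definition omega_regular :: "'a word set \<Rightarrow> bool" where
  "omega_regular L \<longleftrightarrow> (\<exists>M :: ('a, nat) dma. wf_dma M \<and> dma_lang M = L)"


section \<open>Families of DFAs\<close>

text \<open>Only the progress automata of states of the leading automaton are relevant.\<close>

record ('a, 'q, 'p) fdfa =
  leading :: "('a, 'q) dts"
  progress :: "'q \<Rightarrow> ('a, 'p) dfa"

definition wf_fdfa :: "('a, 'q, 'p) fdfa \<Rightarrow> bool" where
  "wf_fdfa F \<longleftrightarrow> wf_dts (leading F) \<and> (\<forall>q \<in> states (leading F). wf_dfa (progress F q))"

definition progress_at :: "('a, 'q, 'p) fdfa \<Rightarrow> 'a list \<Rightarrow> ('a, 'p) dfa" where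
  "progress_at F u = progress F (reach (leading F) u)"

definition decomposition :: "'a list \<Rightarrow> 'a list \<Rightarrow> 'a word \<Rightarrow> bool" where
  "decomposition u v w \<longleftrightarrow> v \<noteq> [] \<and> u \<frown> v\<^sup>\<omega> = w"

definition ultimately_periodic :: "'a word \<Rightarrow> bool" where
  "ultimately_periodic w \<longleftrightarrow> (\<exists>u v. decomposition u v w)"

definition normalized :: "('a, 'q, 'p) fdfa \<Rightarrow> 'a list \<Rightarrow> 'a list \<Rightarrow> bool" where
  "normalized F u v \<longleftrightarrow> reach (leading F) (u @ v) = reach (leading F) u"

definition duo_normalized :: "('a, 'q, 'p) fdfa \<Rightarrow> 'a list \<Rightarrow> 'a list \<Rightarrow> bool" where
  "duo_normalized F u v \<longleftrightarrow> normalized F u v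
     \<and> reach (progress_at F u) (v @ v) = reach (progress_at F u) v"

datatype acceptance = Exact | Normalized | Duo_Normalized

definition fdfa_accepts ::
    "('a, 'q, 'p) fdfa \<Rightarrow> acceptance \<Rightarrow> 'a list \<Rightarrow> 'a list \<Rightarrow> bool" where
  "fdfa_accepts F t u v \<longleftrightarrow> v \<noteq> [] \<and> (case t of
       Exact \<Rightarrow> v \<in> dfa_lang (progress_at F u)
     | Normalized \<Rightarrow> \<exists>x y. decomposition x y (u \<frown> v\<^sup>\<omega>) \<and> normalized F x y
                       \<and> y \<in> dfa_lang (progress_at F x)
     | Duo_Normalized \<Rightarrow> \<exists>x y. decomposition x y (u \<frown> v\<^sup>\<omega>) \<and> duo_normalized F x y
                           \<and> y \<in> dfa_lang (progress_at F x))"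

fun of_type :: "('a, 'q, 'p) fdfa \<Rightarrow> acceptance \<Rightarrow> 'a list \<Rightarrow> 'a list \<Rightarrow> bool" where
  "of_type F Exact u v \<longleftrightarrow> True"
| "of_type F Normalized u v \<longleftrightarrow> normalized F u v"
| "of_type F Duo_Normalized u v \<longleftrightarrow> duo_normalized F u v"

definition saturated :: "('a, 'q, 'p) fdfa \<Rightarrow> acceptance \<Rightarrow> bool" where
  "saturated F t \<longleftrightarrow> (\<forall>w. ultimately_periodic w \<longrightarrow>
     (\<forall>x y x' y'. decomposition x y w \<longrightarrow> of_type F t x y \<longrightarrow>
        decomposition x' y' w \<longrightarrow> of_type F t x' y' \<longrightarrow>
        (y \<in> dfa_lang (progress_at F x) \<longleftrightarrow> y' \<in> dfa_lang (progress_at F x'))))"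

definition fdfa_lang :: "('a, 'q, 'p) fdfa \<Rightarrow> acceptance \<Rightarrow> 'a word set" where
  "fdfa_lang F t = (THE L. omega_regular L
     \<and> {w \<in> L. ultimately_periodic w} = {u \<frown> v\<^sup>\<omega> | u v. fdfa_accepts F t u v})"


section \<open>The diameter measure\<close>

definition persistent :: "('a, 'q, 'p) fdfa \<Rightarrow> 'a list \<Rightarrow> 'a list \<Rightarrow> bool" where
  "persistent F u v \<longleftrightarrow> v \<noteq> [] \<and> duo_normalized F u v
     \<and> (\<forall>z. \<exists>i \<ge> 2. reach (progress_at F u) (z @ v)
                     = reach (progress_at F u) (z @ concat (replicate i v)))"

definition persistent_chain ::
    "('a, 'q, 'p) fdfa \<Rightarrow> acceptance \<Rightarrow> 'a list \<Rightarrow> 'a list list \<Rightarrow> bool" where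
  "persistent_chain F t u vs \<longleftrightarrow>
     (\<forall>v \<in> set vs. persistent F u v)
   \<and> (\<forall>i. Suc i < length vs \<longrightarrow>
        strict_prefix (vs ! i) (vs ! Suc i)
        \<and> (fdfa_accepts F t u (vs ! Suc i) \<longleftrightarrow> \<not> fdfa_accepts F t u (vs ! i)))"

definition fdfa_pos :: "('a, 'q, 'p) fdfa \<Rightarrow> acceptance \<Rightarrow> enat" where
  "fdfa_pos F t = Sup {enat (length vs) | u vs.
     vs \<noteq> [] \<and> persistent_chain F t u vs \<and> fdfa_accepts F t u (hd vs)}"

definition fdfa_neg :: "('a, 'q, 'p) fdfa \<Rightarrow> acceptance \<Rightarrow> enat" where
  "fdfa_neg F t = Sup {enat (length vs) | u vs.
     vs \<noteq> [] \<and> persistent_chain F t u vs \<and> \<not> fdfa_accepts F t u (hd vs)}"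

end

theory Submission
  imports Defs "HOL-Library.FuncSet"
begin

text \<open>
  For every Muller automaton \<open>M\<close> of the language of \<open>F\<close>, the alternating chains of components of \<open>M\<close>
  and the persistent chains of \<open>F\<close> have the same lengths, with the same polarities. From components
  one obtains loops that act idempotently on \<open>F\<close>, each being a prefix of the next. Conversely, a
  persistent \<open>v\<close> may be pumped inside its extensions without changing their effect on \<open>F\<close>, until \<open>M\<close>
  runs through the limit set of \<open>v\<^sup>\<omega>\<close> while it reads the next word; so the limit sets are nested.
  That such an \<open>M\<close> exists at all follows because saturation makes the ultimately periodic words of
  the language invariant under a congruence of finite index. A deterministic automaton can maintain a
  factorisation of the prefix read so far into boundedly many factors, up to this congruence, and
  detect a recurring pair of prefix and period.
\<close>

section \<open>Powers and runs\<close>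

abbreviation pow :: "nat \<Rightarrow> 'a list \<Rightarrow> 'a list" where
  "pow n w \<equiv> concat (replicate n w)"

lemma pow_add: "pow (m + n) w = pow m w @ pow n w"
  by (simp add: replicate_add)

lemma pow_Suc_right: "pow (Suc n) w = pow n w @ w"
  using pow_add[of n 1 w] by simp

lemma pow_mult: "pow (m * n) w = pow m (pow n w)"
  by (induction m) (simp_all add: pow_add del: concat_replicate_trivial)

lemma pow_eq_Nil: "pow n w = [] \<longleftrightarrow> n = 0 \<or> w = []"
  by (cases n) auto

lemma pow_conc_omega: "w \<noteq> [] \<Longrightarrow> pow n w \<frown> w\<^sup>\<omega> = w\<^sup>\<omega>"
  by (induction n) (simp_all flip: conc_conc iter_unroll)

text \<open>The equation moves any position beyond the first \<open>y\<close> back by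
  \<open>length y\<close>, so that first copy determines every letter.\<close>

lemma eq_omega_if_periodic:
  fixes z :: "'a word"
  assumes "y \<noteq> []" "z = y \<frown> z"
  shows "z = y\<^sup>\<omega>"
proof
  fix n
  show "z n = y\<^sup>\<omega> n"
  proof (induction n rule: less_induct)
    case (less n)
    show ?case
    proof (cases "n < length y")
      case True
      then have "z n = y ! n" using assms(2) by (metis conc_fst)
      then show ?thesis using True assms(1) by simp
    next
      case False
      then have "z n = z (n - length y)" using assms(2) by (metis conc_snd)
      also have "\<dots> = y\<^sup>\<omega> (n - length y)" using False assms(1) by (intro less) (cases y; simp)+
      also have "\<dots> = y\<^sup>\<omega> n" using False assms(1) by (simp add: le_mod_geq)
      finally show ?thesis .
    qed
  qed
qed

lemma omega_pow: "n \<ge> 1 \<Longrightarrow> w \<noteq> [] \<Longrightarrow> (pow n w)\<^sup>\<omega> = w\<^sup>\<omega>"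
  by (rule eq_omega_if_periodic[symmetric]) (simp_all add: pow_eq_Nil pow_conc_omega)

text \<open>Beyond \<open>u\<close> the word has period \<open>length v\<close>, hence also period
  \<open>length y\<close>. The tails after \<open>x\<close> and after \<open>x @ y\<close> therefore
  coincide, and \<open>eq_omega_if_periodic\<close> applies.\<close>

lemma ultimately_periodic_split:
  assumes w: "w = u \<frown> v\<^sup>\<omega>" "v \<noteq> []"
    and x: "w = x \<frown> z" "w = (x @ y) \<frown> z'" "length u \<le> length x" "y \<noteq> []"
      "length v dvd length y"
  shows "w = x \<frown> y\<^sup>\<omega>"
proof -
  obtain c where c: "length y = c * length v" using x(5) by (metis dvd_def mult.commute)
  have z: "z = suffix (length x) w" "z' = suffix (length (x @ y)) w"
    using x(1,2) suffix_conc_length[of x z] suffix_conc_length[of "x @ y" z'] by simp_all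
  have "z = z'"
  proof
    fix m
    define k where "k = length x - length u + m"
    have "length x + m = length u + k" "length x + length y + m = length u + (k + c * length v)"
      using x(3) by (simp_all add: k_def c)
    moreover have "w (length u + n) = v ! (n mod length v)" for n
      using w(2) by (simp add: w(1))
    ultimately have "w (length x + length y + m) = w (length x + m)" by simp
    then show "z m = z' m" unfolding z by (simp add: add.assoc)
  qed
  moreover have "z = y \<frown> z'" using x(1,2) by (metis conc_conc same_concat_eq)
  ultimately show ?thesis using x(1,4) eq_omega_if_periodic by metis
qed

text \<open>The state reached at the end is left out, so that traces of consecutive words
  concatenate without overlap and the trace of a loop can serve as a period.\<close>

fun trace :: "('q \<Rightarrow> 'a \<Rightarrow> 'q) \<Rightarrow> 'q \<Rightarrow> 'a list \<Rightarrow> 'q list" where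
  "trace st p [] = []"
| "trace st p (a # x) = p # trace st (st p a) x"

lemma trace_append: "trace st p (x @ y) = trace st p x @ trace st (foldl st p x) y"
  by (induction x arbitrary: p) simp_all

lemma length_trace [simp]: "length (trace st p x) = length x"
  by (induction x arbitrary: p) simp_all

lemma nth_trace: "i < length x \<Longrightarrow> trace st p x ! i = foldl st p (take i x)"
proof (induction x arbitrary: p i)
  case (Cons a x) then show ?case by (cases i) simp_all
qed simp

lemma foldl_pow_fixed: "foldl st p x = p \<Longrightarrow> foldl st p (pow n x) = p"
  by (induction n) simp_all

lemma set_trace_pow:
  assumes "foldl st p x = p" "n \<ge> 1"
  shows "set (trace st p (pow n x)) = set (trace st p x)"
  using assms(2) by (induction n rule: dec_induct) (auto simp: trace_append assms(1))

section \<open>Runs of automata and their limit sets\<close>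

lemma foldl_step_closed:
  "wf_dts A \<Longrightarrow> p \<in> states A \<Longrightarrow> foldl (step A) p w \<in> states A"
  by (induction w arbitrary: p) (auto simp: wf_dts_def)

lemma reach_closed: "wf_dts A \<Longrightarrow> reach A w \<in> states A"
  unfolding reach_def by (rule foldl_step_closed) (auto simp: wf_dts_def)

lemma reach_append: "reach A (u @ v) = foldl (step A) (reach A u) v"
  by (simp add: reach_def)

lemma run_conc: "run A (x \<frown> z) = trace (step A) (start A) x \<frown>
    (\<lambda>n. foldl (step A) (reach A x) (map z [0..<n]))"
proof
  fix n
  have [simp]: "map (x \<frown> z) [0..<n] = Omega_Words_Fun.prefix n (x \<frown> z)" "map z [0..<m] = Omega_Words_Fun.prefix m z" for m
    by (simp_all add: subsequence_def)
  show "run A (x \<frown> z) n = (trace (step A) (start A) x \<frown>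
    (\<lambda>n. foldl (step A) (reach A x) (map z [0..<n]))) n"
    by (cases "n < length x") (simp_all add: run_def nth_trace reach_def)
qed

text \<open>After \<open>x\<close> the run repeats the trace of the loop forever, and the limit of a
  periodic word is the set of letters of its period.\<close>

lemma limit_run_loop:
  assumes "y \<noteq> []" "foldl (step A) (reach A x) y = reach A x"
  shows "limit (run A (x \<frown> y\<^sup>\<omega>)) = set (trace (step A) (reach A x) y)"
proof -
  let ?r = "\<lambda>n. foldl (step A) (reach A x) (map (y\<^sup>\<omega>) [0..<n])"
  have "?r = trace (step A) (reach A x) y \<frown> ?r"
  proof
    fix n
    have eq: "map (y\<^sup>\<omega>) [0..<n] = Omega_Words_Fun.prefix n (y \<frown> y\<^sup>\<omega>)" for n
      using assms(1) by (simp add: subsequence_def flip: iter_unroll)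
    have eq': "map (y\<^sup>\<omega>) [0..<n] = Omega_Words_Fun.prefix n (y\<^sup>\<omega>)" for n
      by (simp add: subsequence_def)
    show "?r n = (trace (step A) (reach A x) y \<frown> ?r) n"
    proof (cases "n < length y")
      case True
      then show ?thesis by (simp add: eq nth_trace)
    next
      case False
      then show ?thesis by (simp add: eq[of n] assms(2)) (simp add: eq')
    qed
  qed
  then have "?r = (trace (step A) (reach A x) y)\<^sup>\<omega>"
    using assms(1) by (intro eq_omega_if_periodic) (auto simp flip: length_greater_0_conv)
  then show ?thesis
    using assms(1) by (simp add: run_conc)
qed

lemma range_run: "wf_dts A \<Longrightarrow> range (run A w) \<subseteq> states A"
  by (auto simp: run_def reach_closed)

lemma finite_range_run: "wf_dts A \<Longrightarrow> finite (range (run A w))"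
  using finite_subset[OF range_run] by (auto simp: wf_dts_def)

lemma limit_run_subset: "wf_dts A \<Longrightarrow> limit (run A w) \<subseteq> states A"
  using limit_in_range range_run by fast

text \<open>An omega-word can be cut so that a single loop reproduces its limit sets in both automata;
  hence the symmetric difference of two regular languages, if nonempty, contains an ultimately
  periodic word.\<close>

lemma common_loop:
  assumes A: "wf_dts A" and B: "wf_dts B"
  obtains x y where "y \<noteq> []" "limit (run A (x \<frown> y\<^sup>\<omega>)) = limit (run A w)"
    "limit (run B (x \<frown> y\<^sup>\<omega>)) = limit (run B w)"
proof -
  let ?f = "run A w" and ?g = "run B w"
  have fin: "finite (range ?f)" "finite (range ?g)" using A B finite_range_run by blast+
  obtain i where i: "limit ?f = range (suffix i ?f)" "limit ?g = range (suffix i ?g)"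
    using common_range_limit[OF fin] by metis
  have "finite (range (\<lambda>n. (?f n, ?g n)))"
    by (rule finite_subset[of _ "range ?f \<times> range ?g"]) (use fin in auto)
  \<comment> \<open>A pair of states visited simultaneously infinitely often marks both ends of a
    loop that works for both automata at once.\<close>
  then obtain pq where "\<exists>\<^sub>\<infinity>n. (?f n, ?g n) = pq"
    using limit_nonempty limit_iff_frequent by metis
  then obtain p q where pq: "\<exists>\<^sub>\<infinity>n. ?f n = p \<and> ?g n = q" by (cases pq) auto
  then obtain j where j: "j \<ge> i" "?f j = p" "?g j = q" unfolding INFM_nat_le by auto
  \<comment> \<open>All recurring states show up within a bounded window after
    \<open>j\<close>.\<close>
  have bnd: "\<exists>m. \<forall>s \<in> limit r. \<exists>n. j \<le> n \<and> n < m \<and> r n = s" if "finite (range r)" for r :: "nat \<Rightarrow> 'z"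
  proof -
    have "\<forall>s \<in> limit r. \<exists>n \<ge> j. r n = s" by (auto simp: limit_iff_frequent INFM_nat_le)
    then obtain N where N: "\<And>s. s \<in> limit r \<Longrightarrow> N s \<ge> j \<and> r (N s) = s" by metis
    have "finite (limit r)" using that limit_in_range finite_subset by metis
    then have "\<forall>s \<in> limit r. N s < Suc (Max (N ` limit r))" by (simp add: less_Suc_eq_le)
    then show ?thesis using N by blast
  qed
  obtain m1 m2 where m: "\<forall>s \<in> limit ?f. \<exists>n. j \<le> n \<and> n < m1 \<and> ?f n = s"
    "\<forall>s \<in> limit ?g. \<exists>n. j \<le> n \<and> n < m2 \<and> ?g n = s"
    using bnd[OF fin(1)] bnd[OF fin(2)] by blast
  \<comment> \<open>Being past both windows, \<open>k\<close> closes a loop that visits every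
    recurring state. The summand \<open>Suc j\<close> keeps the loop word nonempty.\<close>
  obtain k where k: "k \<ge> m1 + m2 + Suc j" "?f k = p" "?g k = q" using pq unfolding INFM_nat_le by blast
  define x where "x = map w [0..<j]"
  define y where "y = map w [j..<k]"
  have y: "y \<noteq> []" using k by (simp add: y_def)
  have loop: "limit (run C (x \<frown> y\<^sup>\<omega>)) = limit (run C w)"
    if C: "limit (run C w) = range (suffix i (run C w))"
      "\<forall>s \<in> limit (run C w). \<exists>n. j \<le> n \<and> n < k \<and> run C w n = s" "run C w j = run C w k"
    for C :: "('a, 'z, 'm) dts_scheme"
  proof -
    have st: "foldl (step C) (reach C x) (take n y) = run C w (j + n)" if "j + n \<le> k" for n
    proof -
      have "map w [0..<j + n] = x @ take n y"
        using that by (simp add: x_def y_def take_map upt_add_eq_append[of 0 j n, simplified])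
      then show ?thesis by (simp add: run_def reach_append)
    qed
    have len: "j + n \<le> k" if "n < length y" for n using that by (simp add: y_def)
    have "set (trace (step C) (reach C x) y) = (\<lambda>n. run C w (j + n)) ` {..<length y}"
    proof -
      have "set (trace (step C) (reach C x) y) = (!) (trace (step C) (reach C x) y) ` {..<length y}"
        by (auto simp: set_conv_nth)
      also have "\<dots> = (\<lambda>n. run C w (j + n)) ` {..<length y}"
        by (rule image_cong) (simp_all add: nth_trace st[OF len])
      finally show ?thesis .
    qed
    also have "\<dots> = limit (run C w)"
    proof
      show "(\<lambda>n. run C w (j + n)) ` {..<length y} \<subseteq> limit (run C w)"
      proof (rule image_subsetI)
        fix n
        have "j + n = i + (j - i + n)" using j(1) by simp
        then show "run C w (j + n) \<in> limit (run C w)" unfolding C(1) suffix_def by (metis rangeI)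
      qed
      show "limit (run C w) \<subseteq> (\<lambda>n. run C w (j + n)) ` {..<length y}"
      proof
        fix s assume "s \<in> limit (run C w)"
        then obtain n where "j \<le> n" "n < k" "run C w n = s" using C(2) by blast
        then show "s \<in> (\<lambda>n. run C w (j + n)) ` {..<length y}"
          by (intro image_eqI[of _ _ "n - j"]) (auto simp: y_def)
      qed
    qed
    finally have "set (trace (step C) (reach C x) y) = limit (run C w)" .
    moreover have "j + length y = k" using k(1) by (simp add: y_def)
    then have "foldl (step C) (reach C x) y = reach C x"
      using st[of "length y"] st[of 0] C(3) by simp
    ultimately show ?thesis using limit_run_loop[OF y, of C x] by simp
  qed
  show ?thesis
  proof (rule that[OF y])
    show "limit (run A (x \<frown> y\<^sup>\<omega>)) = limit (run A w)"
    proof (rule loop[OF i(1)])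
      show "\<forall>s \<in> limit ?f. \<exists>n. j \<le> n \<and> n < k \<and> ?f n = s" using m(1) k(1) by (meson less_le_trans add_leD1)
    qed (simp add: j k)
    show "limit (run B (x \<frown> y\<^sup>\<omega>)) = limit (run B w)"
    proof (rule loop[OF i(2)])
      show "\<forall>s \<in> limit ?g. \<exists>n. j \<le> n \<and> n < k \<and> ?g n = s" using m(2) k(1) by (meson less_le_trans add_leD1 add_leD2)
    qed (simp add: j k)
  qed
qed

lemma ultimately_periodicI: "y \<noteq> [] \<Longrightarrow> ultimately_periodic (x \<frown> y\<^sup>\<omega>)"
  by (auto simp: ultimately_periodic_def decomposition_def)

text \<open>Supplies the uniqueness that the definite description in \<open>fdfa_lang\<close>
  needs.\<close>

lemma omega_regular_eqI:
  assumes "omega_regular L" "omega_regular L'"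
    and "{w \<in> L. ultimately_periodic w} = {w \<in> L'. ultimately_periodic w}"
  shows "L = L'"
proof -
  obtain A B :: "('a, nat) dma" where AB: "wf_dma A" "L = dma_lang A" "wf_dma B" "L' = dma_lang B"
    using assms(1,2) by (auto simp: omega_regular_def)
  have "w \<in> L \<longleftrightarrow> w \<in> L'" for w
  proof -
    obtain x y where xy: "y \<noteq> []" "limit (run A (x \<frown> y\<^sup>\<omega>)) = limit (run A w)"
      "limit (run B (x \<frown> y\<^sup>\<omega>)) = limit (run B w)"
      using common_loop[of A B w] AB unfolding wf_dma_def by metis
    then show ?thesis
      using assms(3) ultimately_periodicI[OF xy(1), of x] unfolding AB dma_lang_def
      by (simp add: set_eq_iff[where A = "Collect _"]) (metis xy(2,3))
  qed
  then show ?thesis by blast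
qed

section \<open>Finite congruences\<close>

locale finite_congruence =
  fixes h :: "'a list \<Rightarrow> 'c"
  assumes finite_range: "finite (range h)"
    and append_cong: "h u = h u' \<Longrightarrow> h v = h v' \<Longrightarrow> h (u @ v) = h (u' @ v')"
begin

text \<open>By the pigeonhole principle the classes of the powers are eventually periodic. A
  multiple of the period beyond the preperiod \<open>i\<close> is the required exponent, since
  doubling it adds whole periods only.\<close>

lemma idempotent_pow: "\<exists>n \<ge> 1. h (pow n w @ pow n w) = h (pow n w)"
proof -
  have "finite (range (\<lambda>i. h (pow i w)))" by (rule finite_subset[OF _ finite_range]) auto
  then have "\<not> inj (\<lambda>i. h (pow i w))" using finite_imageD[of _ UNIV] by fastforce
  then obtain i j where "i < j" and ij: "h (pow i w) = h (pow j w)"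
    by (auto simp: inj_def) (metis linorder_neqE_nat)
  then obtain p where p: "j = i + p" "p \<ge> 1" by (metis less_imp_add_positive less_eq_Suc_le One_nat_def)
  have period: "h (pow (i + m) w) = h (pow (i + m + p * c) w)" for m c
  proof (induction c)
    case (Suc c)
    have "h (pow i w @ pow (m + p * c) w) = h (pow j w @ pow (m + p * c) w)"
      by (rule append_cong) (simp_all add: ij)
    then have "h (pow (i + (m + p * c)) w) = h (pow (j + (m + p * c)) w)"
      by (simp only: pow_add)
    moreover have "i + (m + p * c) = i + m + p * c" "j + (m + p * c) = i + m + p * Suc c"
      by (simp_all add: p)
    ultimately show ?case using Suc by simp
  qed simp
  define n where "n = p * Suc i"
  have "n \<ge> Suc i" using p(2) by (cases p) (simp_all add: n_def)
  moreover from this have "h (pow n w) = h (pow (n + n) w)"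
    using period[of "n - i" "Suc i"] by (simp add: n_def)
  ultimately show ?thesis by (intro exI[of _ n]) (simp add: pow_add)
qed

end

text \<open>Restricting to the carrier keeps the number of actions finite even if the type of states
  is infinite.\<close>

definition action :: "('a, 'q, 'z) dts_scheme \<Rightarrow> 'a list \<Rightarrow> 'q \<Rightarrow> 'q" where
  "action A w = restrict (\<lambda>q. foldl (step A) q w) (states A)"

lemma action_eqD:
  "action A u = action A v \<Longrightarrow> q \<in> states A \<Longrightarrow> foldl (step A) q u = foldl (step A) q v"
  by (auto simp: action_def restrict_def fun_eq_iff split: if_splits)

lemma action_eqI:
  "(\<And>q. q \<in> states A \<Longrightarrow> foldl (step A) q u = foldl (step A) q v) \<Longrightarrow> action A u = action A v"
  by (auto simp: action_def restrict_def fun_eq_iff)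

lemma finite_congruence_action: "wf_dts A \<Longrightarrow> finite_congruence (action A)"
proof
  assume A: "wf_dts A"
  have "range (action A) \<subseteq> (\<Pi>\<^sub>E q \<in> states A. states A)"
    using A by (auto simp: action_def foldl_step_closed)
  then show "finite (range (action A))"
    using A finite_subset[OF _ finite_PiE[of "states A" "\<lambda>_. states A"]] by (simp add: wf_dts_def)
  show "action A (u @ v) = action A (u' @ v')" if "action A u = action A u'" "action A v = action A v'"
    for u u' v v'
    by (rule action_eqI) (simp add: action_eqD[OF that(1)] action_eqD[OF that(2)] A foldl_step_closed)
qed

lemma finite_congruence_pair:
  assumes "finite_congruence h" "finite_congruence g"
  shows "finite_congruence (\<lambda>w. (h w, g w))"
proof -
  interpret h: finite_congruence h by fact
  interpret g: finite_congruence g by fact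
  show ?thesis
  proof
    show "finite (range (\<lambda>w. (h w, g w)))"
      by (rule finite_subset[of _ "range h \<times> range g"]) (use h.finite_range g.finite_range in auto)
  qed (use h.append_cong g.append_cong in blast)
qed

lemma finite_congruence_family:
  assumes "finite I" "\<And>i. i \<in> I \<Longrightarrow> finite_congruence (h i)"
  shows "finite_congruence (\<lambda>w. restrict (\<lambda>i. h i w) I)"
proof
  have "range (\<lambda>w. restrict (\<lambda>i. h i w) I) \<subseteq> (\<Pi>\<^sub>E i \<in> I. range (h i))" by auto
  moreover have "finite (\<Pi>\<^sub>E i \<in> I. range (h i))"
    using assms by (intro finite_PiE) (auto simp: finite_congruence_def)
  ultimately show "finite (range (\<lambda>w. restrict (\<lambda>i. h i w) I))" using finite_subset by blast
  fix u u' v v'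
  assume eq: "restrict (\<lambda>i. h i u) I = restrict (\<lambda>i. h i u') I" "restrict (\<lambda>i. h i v) I = restrict (\<lambda>i. h i v') I"
  have "h i (u @ v) = h i (u' @ v')" if "i \<in> I" for i
  proof (rule finite_congruence.append_cong[OF assms(2)[OF that]])
    show "h i u = h i u'" "h i v = h i v'"
      using fun_cong[OF eq(1), of i] fun_cong[OF eq(2), of i] that by simp_all
  qed
  then show "restrict (\<lambda>i. h i (u @ v)) I = restrict (\<lambda>i. h i (u' @ v')) I"
    by (auto simp: restrict_def)
qed

text \<open>The joint transition action on the leading automaton and on all progress automata. The
  latter are indexed by leading states only, since \<open>wf_fdfa\<close> constrains no
  others.\<close>

definition fdfa_action :: "('a, 'q, 'p) fdfa \<Rightarrow> 'a list \<Rightarrow> ('q \<Rightarrow> 'q) \<times> ('q \<Rightarrow> 'p \<Rightarrow> 'p)" where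
  "fdfa_action F w = (action (leading F) w,
     restrict (\<lambda>q. action (progress F q) w) (states (leading F)))"

lemma finite_congruence_fdfa_action: "wf_fdfa F \<Longrightarrow> finite_congruence (fdfa_action F)"
  unfolding fdfa_action_def wf_fdfa_def wf_dfa_def
  by (intro finite_congruence_pair finite_congruence_family finite_congruence_action)
    (auto simp: wf_dts_def)

lemma wf_progress_at: "wf_fdfa F \<Longrightarrow> wf_dts (progress_at F u)"
  by (auto simp: wf_fdfa_def wf_dfa_def progress_at_def reach_closed)

lemma fdfa_action_leading:
  assumes "wf_fdfa F" "fdfa_action F u = fdfa_action F v"
  shows "reach (leading F) (x @ u) = reach (leading F) (x @ v)"
  using assms action_eqD[of "leading F" u v] by (auto simp: fdfa_action_def reach_append wf_fdfa_def reach_closed)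

lemma fdfa_action_progress:
  assumes "wf_fdfa F" "fdfa_action F u = fdfa_action F v"
  shows "reach (progress_at F x) (z @ u) = reach (progress_at F x) (z @ v)"
proof -
  have "action (progress_at F x) u = action (progress_at F x) v"
    using assms fun_cong[of _ _ "reach (leading F) x"]
    by (auto simp: fdfa_action_def restrict_def progress_at_def wf_fdfa_def reach_closed split: if_splits dest!: fun_cong[of _ _ "reach (leading F) x"])
  then show ?thesis
    by (auto simp: reach_append dest!: action_eqD intro!: reach_closed wf_progress_at[OF assms(1)])
qed

section \<open>A Muller automaton for a congruence of finite index\<close>

text \<open>Renaming states along the injection \<open>to_nat\<close> preserves acceptance. This
  admits automata whose states are lists of words, although \<open>omega_regular\<close> asks for
  states in \<open>nat\<close>.\<close>

lemma omega_regular_dma_lang: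
  fixes M :: "('a, 'q::countable) dma"
  assumes "wf_dma M"
  shows "omega_regular (dma_lang M)"
proof -
  define N :: "('a, nat) dma" where "N = \<lparr>states = to_nat ` states M, start = to_nat (start M),
    step = (\<lambda>m a. to_nat (step M (from_nat m) a)), table = image to_nat ` table M\<rparr>"
  have "foldl (step N) (to_nat q) w = to_nat (foldl (step M) q w)" for q w
    by (induction w arbitrary: q) (simp_all add: N_def)
  then have "reach N w = to_nat (reach M w)" for w
    by (simp add: reach_def N_def)
  then have "run N w = to_nat \<circ> run M w" for w
    by (simp add: run_def fun_eq_iff)
  then have "dma_lang N = dma_lang M"
    by (auto simp: dma_lang_def N_def inj_image_eq_iff image_iff)
  moreover have "wf_dma N"
    using assms by (fastforce simp: wf_dma_def wf_dts_def N_def)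
  ultimately show ?thesis by (auto simp: omega_regular_def)
qed

text \<open>Cut \<open>r\<close> is the boundary in front of the factor \<open>ws ! r\<close>;
  dropping it merges this factor into its predecessor.\<close>

definition remove_cut :: "nat \<Rightarrow> 'a list list \<Rightarrow> 'a list list" where
  "remove_cut r ws = take (r - 1) ws @ (ws ! (r - 1) @ ws ! r) # drop (Suc r) ws"

lemma remove_cutE:
  assumes "1 \<le> r" "r < length ws"
  obtains A b c D where "ws = A @ b # c # D" "length A = r - 1" "remove_cut r ws = A @ (b @ c) # D"
proof
  have "drop (r - 1) ws = ws ! (r - 1) # ws ! r # drop (Suc r) ws"
    using assms Cons_nth_drop_Suc[of "r - 1" ws] Cons_nth_drop_Suc[of r ws] by simp
  then show "ws = take (r - 1) ws @ ws ! (r - 1) # ws ! r # drop (Suc r) ws"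
    by (metis append_take_drop_id)
qed (use assms in \<open>auto simp: remove_cut_def\<close>)

lemma remove_cut_props:
  assumes "1 \<le> r" "r < length ws"
  shows "concat (remove_cut r ws) = concat ws" "Suc (length (remove_cut r ws)) = length ws"
    "l < r \<Longrightarrow> take l (remove_cut r ws) = take l ws"
    "concat (take r (remove_cut r ws)) = concat (take (Suc r) ws)"
    "[] \<notin> set ws \<Longrightarrow> [] \<notin> set (remove_cut r ws)"
proof -
  obtain A b c D where *: "ws = A @ b # c # D" "length A = r - 1" "remove_cut r ws = A @ (b @ c) # D"
    using remove_cutE[OF assms] .
  then have r: "r = Suc (length A)" using assms(1) by simp
  show "concat (remove_cut r ws) = concat ws" "Suc (length (remove_cut r ws)) = length ws"
    "concat (take r (remove_cut r ws)) = concat (take (Suc r) ws)"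
    "[] \<notin> set ws \<Longrightarrow> [] \<notin> set (remove_cut r ws)"
    using *(3) by (auto simp: *(1) r)
  show "take l (remove_cut r ws) = take l ws" if "l < r"
    using that *(3) by (simp add: *(1) r)
qed

context finite_congruence
begin

text \<open>Representatives are nonempty because they serve as periods, and \<open>[]\<^sup>\<omega>\<close> is undefined.\<close>

definition rep :: "'a list \<Rightarrow> 'a list" where
  "rep w = (SOME v. v \<noteq> [] \<and> h v = h w)"

lemma rep: "w \<noteq> [] \<Longrightarrow> rep w \<noteq> [] \<and> h (rep w) = h w"
  unfolding rep_def by (rule someI) simp

lemma rep_cong: "h v = h w \<Longrightarrow> rep v = rep w"
  by (simp add: rep_def)

lemma finite_range_rep: "finite (range rep)"
proof (rule finite_subset)
  show "range rep \<subseteq> (\<lambda>c. SOME v. v \<noteq> [] \<and> h v = c) ` range h" by (auto simp: rep_def)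
qed (simp add: finite_range)

lemma h_concat_rep: "[] \<notin> set ws \<Longrightarrow> h (concat (map rep ws)) = h (concat ws)"
proof (induction ws)
  case (Cons v ws)
  then show ?case using rep[of v] append_cong[of "rep v" v] by auto
qed simp

section \<open>Redundant cuts and the update of a factorisation\<close>

abbreviation bound :: nat where
  "bound \<equiv> card (range h)"

definition redundant :: "'a list list \<Rightarrow> nat \<times> nat \<Rightarrow> bool" where
  "redundant ws = (\<lambda>(l, r). l < r \<and> r < length ws
     \<and> h (concat (drop l ws)) = h (concat (drop r ws)))"

text \<open>Any choice will do as long as it depends only on the classes of the suffixes.
  \<open>SOME\<close> applied to the predicate \<open>redundant ws\<close> guarantees this.\<close>

definition cut :: "'a list list \<Rightarrow> nat \<times> nat" where
  "cut ws = (SOME lr. redundant ws lr)"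

lemma redundant_cut:
  assumes "bound < length ws"
  shows "redundant ws (cut ws)"
proof -
  let ?f = "\<lambda>l. h (concat (drop l ws))"
  have "card (?f ` {..<length ws}) \<le> bound" by (rule card_mono[OF finite_range]) auto
  then have "\<not> inj_on ?f {..<length ws}" using assms by (intro pigeonhole) simp
  then obtain l r where "l < length ws" "r < length ws" "?f l = ?f r" "l \<noteq> r"
    by (auto simp: inj_on_def)
  then have "redundant ws (l, r) \<or> redundant ws (r, l)" by (auto simp: redundant_def)
  then show ?thesis unfolding cut_def by (metis someI)
qed

lemma cut_bounds:
  assumes "bound < length ws"
  shows "fst (cut ws) < snd (cut ws)" "snd (cut ws) < length ws"
    "h (concat (drop (fst (cut ws)) ws)) = h (concat (drop (snd (cut ws)) ws))"
  using redundant_cut[OF assms] by (auto simp: redundant_def split: prod.splits)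

text \<open>Representatives leave the class of every suffix unchanged, so both predicates
  \<open>redundant\<close> are equal and \<open>SOME\<close> picks the same pair.\<close>

lemma cut_rep:
  assumes "[] \<notin> set ws"
  shows "cut (map rep ws) = cut ws"
proof -
  have "h (concat (drop l (map rep ws))) = h (concat (drop l ws))" for l
    using assms h_concat_rep[of "drop l ws"] by (auto simp: drop_map dest: in_set_dropD)
  then have "redundant (map rep ws) = redundant ws" by (simp add: redundant_def fun_eq_iff)
  then show ?thesis by (simp add: cut_def)
qed

text \<open>The cut is dropped before the new letter becomes a factor of its own, so that, starting
  from the empty list, the length settles at \<open>Suc bound\<close>.\<close>

definition extend :: "'a list list \<Rightarrow> 'a \<Rightarrow> 'a list list" where
  "extend ws a = (if bound < length ws then remove_cut (snd (cut ws)) ws else ws) @ [[a]]"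

lemma extend_props:
  shows "concat (extend ws a) = concat ws @ [a]"
    "length (extend ws a) = min (Suc (length ws)) (max (Suc bound) (length ws))"
    "[] \<notin> set ws \<Longrightarrow> [] \<notin> set (extend ws a)"
  using remove_cut_props[of "snd (cut ws)" ws] cut_bounds[of ws] by (auto simp: extend_def)

lemma remove_cut_rep:
  assumes "[] \<notin> set ws" "1 \<le> r" "r < length ws"
  shows "map rep (remove_cut r (map rep ws)) = map rep (remove_cut r ws)"
proof -
  have idem: "rep (rep x) = rep x" if "x \<in> set ws" for x
    using that assms(1) rep rep_cong by metis
  have "rep (rep (ws ! (r - 1)) @ rep (ws ! r)) = rep (ws ! (r - 1) @ ws ! r)"
    by (rule rep_cong, rule append_cong) (use assms rep nth_mem in \<open>metis less_imp_diff_less\<close>)+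
  then show ?thesis
    using assms(2,3) idem by (auto simp: remove_cut_def take_map drop_map dest: in_set_takeD in_set_dropD)
qed

text \<open>The automaton remembers representatives only. This commutation shows that they suffice
  for computing the next state.\<close>

lemma extend_rep:
  assumes "[] \<notin> set ws"
  shows "map rep (extend (map rep ws) a) = map rep (extend ws a)"
proof (cases "bound < length ws")
  case True
  then show ?thesis
    using cut_bounds[OF True] remove_cut_rep[OF assms, of "snd (cut ws)"]
    by (simp add: extend_def cut_rep[OF assms])
next
  case False
  have "rep (rep x) = rep x" if "x \<in> set ws" for x
    using that assms rep rep_cong by metis
  then show ?thesis using False by (simp add: extend_def)
qed

text \<open>A state is a factorisation of the word read so far, each factor replaced by its
  representative. Once there are more factors than classes, two suffixes of the factorisation, cut
  at \<open>l < r\<close>, are congruent and thus indistinguishable from then on; the cut at \<open>r\<close> is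
  dropped, and the factors between \<open>l\<close> and \<open>r\<close> become a candidate for the period.
  Only the least \<open>r\<close> that is dropped infinitely often counts: the cuts below it are
  eventually fixed.\<close>

definition factorization_dma :: "'a word set \<Rightarrow> ('a, 'a list list) dma" where
  "factorization_dma W = \<lparr>states = {xs. set xs \<subseteq> range rep \<and> length xs \<le> Suc bound},
     start = [], step = (\<lambda>xs a. map rep (extend xs a)),
     table = {I. I \<subseteq> {xs. set xs \<subseteq> range rep \<and> length xs \<le> Suc bound} \<and>
       (\<exists>xs \<in> I. bound < length xs \<and> (\<forall>ys \<in> I. snd (cut xs) \<le> snd (cut ys)) \<and>
         concat (take (fst (cut xs)) xs) \<frown>
           (concat (drop (fst (cut xs)) (take (snd (cut xs)) xs)))\<^sup>\<omega> \<in> W)}\<rparr>"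

lemma wf_factorization_dma: "wf_dma (factorization_dma W)"
  using finite_lists_length_le[OF finite_range_rep, of "Suc bound"] extend_props(2)
  by (auto simp: wf_dma_def wf_dts_def factorization_dma_def)

text \<open>Invariance is asked for linked pairs only: \<open>y\<close> is idempotent and
  \<open>x\<close> absorbs it. Under \<open>fdfa_action\<close> such pairs are duo-normalized, which
  is where saturation applies for all three acceptance types.\<close>

definition recognizes :: "'a word set \<Rightarrow> bool" where
  "recognizes W \<longleftrightarrow> (\<forall>x y x' y'. y \<noteq> [] \<longrightarrow> y' \<noteq> [] \<longrightarrow> h x = h x' \<longrightarrow> h y = h y' \<longrightarrow>
     h (y @ y) = h y \<longrightarrow> h (x @ y) = h x \<longrightarrow> (x \<frown> y\<^sup>\<omega> \<in> W \<longleftrightarrow> x' \<frown> y'\<^sup>\<omega> \<in> W))"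

text \<open>The actual factorisation, of which a state of the automaton is the image under
  \<open>rep\<close>.\<close>

definition factors :: "'a word \<Rightarrow> nat \<Rightarrow> 'a list list" where
  "factors w k = foldl extend [] (map w [0..<k])"

lemma factors_Suc: "factors w (Suc k) = extend (factors w k) (w k)"
  by (simp add: factors_def)

section \<open>Correctness of the factorisation automaton on ultimately periodic words\<close>

lemma factors_props:
  shows "concat (factors w k) = map w [0..<k]"
    "length (factors w k) = min k (Suc bound)"
    "[] \<notin> set (factors w k)"
proof (induction k)
  case (Suc k)
  {
    case 1
    show ?case by (simp add: factors_Suc extend_props(1) Suc(1))
  next
    case 2
    show ?case by (auto simp: factors_Suc extend_props(2) Suc(2))
  next
    case 3
    show ?case by (simp add: factors_Suc extend_props(3) Suc(3))
  }
qed (simp_all add: factors_def)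

lemma run_factorization_dma: "run (factorization_dma W) w k = map rep (factors w k)"
proof (induction k)
  case (Suc k)
  then show ?case
    by (simp add: run_def reach_append factors_Suc)
      (simp add: factorization_dma_def extend_rep factors_props(3))
qed (simp add: run_def reach_def factors_def factorization_dma_def)

text \<open>Let \<open>(l, r)\<close> be the cut of \<open>xs\<close>. Eventually the cuts below
  \<open>r\<close> are frozen, while every visit to \<open>xs\<close> drops \<open>r\<close> and so
  enlarges the block between \<open>l\<close> and \<open>r\<close>. The growth between two suitable
  visits is a period of \<open>w\<close>, and the congruence of the suffixes at \<open>l\<close> and
  \<open>r\<close> puts it into the same idempotent class as the block itself.\<close>

lemma recurrent_state:
  assumes W: "recognizes W"
    and w: "w = u \<frown> v\<^sup>\<omega>" "v \<noteq> []"
    and xs: "xs \<in> limit (run (factorization_dma W) w)"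
      "\<And>ys. ys \<in> limit (run (factorization_dma W) w) \<Longrightarrow> snd (cut xs) \<le> snd (cut ys)"
  shows "bound < length xs"
    "concat (take (fst (cut xs)) xs) \<frown> (concat (drop (fst (cut xs)) (take (snd (cut xs)) xs)))\<^sup>\<omega> \<in> W
      \<longleftrightarrow> w \<in> W"
proof -
  let ?run = "run (factorization_dma W) w" and ?G = "factors w"
  define l where "l = fst (cut xs)"
  define r where "r = snd (cut xs)"
  define T where "T = {k. map rep (?G k) = xs}"
  have T: "infinite T"
    using xs(1) by (simp add: limit_vimage vimage_def run_factorization_dma T_def)
  have cut_T: "cut (?G k) = (l, r)" if "k \<in> T" for k
    using cut_rep[OF factors_props(3)] that by (simp add: T_def l_def r_def) (metis prod.collapse)
  have G_long: "length (?G k) = Suc bound" if "Suc bound \<le> k" for k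
    using that by (simp add: factors_props(2))
  obtain k where "k \<in> T" "Suc bound \<le> k" using T by (metis infinite_nat_iff_unbounded_le)
  then show "bound < length xs" using G_long by (auto simp: T_def)
  have "finite (range ?run)"
    using wf_factorization_dma[of W] by (intro finite_range_run) (simp add: wf_dma_def)
  then obtain i where "limit ?run = range (suffix i ?run)" using limit_is_suffix by metis
  then have i: "?run k \<in> limit ?run" if "i \<le> k" for k
    using that by (metis le_add_diff_inverse rangeI suffix_nth)
  \<comment> \<open>From \<open>k0\<close> on only recurring states occur and every step drops a
    cut; by minimality that cut is never below \<open>r\<close>.\<close>
  define k0 where "k0 = max i (Suc bound)"
  have r_le: "r \<le> snd (cut (?G k))" if "k0 \<le> k" for k
    using xs(2)[OF i, of k] that cut_rep[OF factors_props(3)] by (simp add: k0_def run_factorization_dma r_def)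
  have G: "?G (Suc k) = remove_cut (snd (cut (?G k))) (?G k) @ [[w k]]"
    "1 \<le> snd (cut (?G k))" "snd (cut (?G k)) < length (?G k)" "length (?G k) = Suc bound" if "k0 \<le> k" for k
    using that G_long[of k] cut_bounds[of "?G k"] by (auto simp: k0_def factors_Suc extend_def)
  have take_Suc: "take m (?G (Suc k)) = take m (?G k)" if "k0 \<le> k" "m < snd (cut (?G k))" for k m
    using G[OF that(1)] remove_cut_props(2,3)[of "snd (cut (?G k))" "?G k"] that by simp
  have base: "take m (?G k) = take m (?G k0)" if "k0 \<le> k" "m < r" for k m
    using that(1)
  proof (induction k rule: dec_induct)
    case (step k)
    then show ?case using take_Suc[of k m] r_le[of k] that(2) by simp
  qed simp
  \<comment> \<open>The position of cut \<open>r\<close> in \<open>w\<close> after \<open>k\<close>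
    letters. It never moves left, and it moves right whenever \<open>r\<close> is dropped, since the
    factor merged into its left neighbour is nonempty.\<close>
  define c where "c k = length (concat (take r (?G k)))" for k
  have c_Suc: "c k \<le> c (Suc k)" "snd (cut (?G k)) = r \<Longrightarrow> c k < c (Suc k)" if k: "k0 \<le> k" for k
  proof -
    show less: "c k < c (Suc k)" if eq: "snd (cut (?G k)) = r"
    proof -
      have "concat (take r (?G (Suc k))) = concat (take (Suc r) (?G k))"
        using G[OF k] remove_cut_props(2,4)[of r "?G k"] eq by simp
      also have "\<dots> = concat (take r (?G k)) @ ?G k ! r"
        using G(3)[OF k] eq by (simp add: take_Suc_conv_app_nth)
      moreover have "?G k ! r \<noteq> []" using G(3)[OF k] eq factors_props(3) nth_mem by metis
      ultimately show ?thesis by (simp add: c_def)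
    qed
    show "c k \<le> c (Suc k)"
    proof (cases "snd (cut (?G k)) = r")
      case True
      then show ?thesis using less by simp
    next
      case False
      then have "r < snd (cut (?G k))" using r_le[OF k] by simp
      then show ?thesis using take_Suc[OF k] by (simp add: c_def)
    qed
  qed
  have c_mono: "c k \<le> c k'" if "k0 \<le> k" "k \<le> k'" for k k'
    using that(2) by (induction k' rule: dec_induct) (use c_Suc(1) that(1) in \<open>auto intro: order_trans\<close>)
  have unbounded: "\<exists>K \<ge> k0. \<forall>k \<ge> K. m \<le> c k" for m
  proof (induction m)
    case (Suc m)
    then obtain K where K: "K \<ge> k0" "\<And>k. k \<ge> K \<Longrightarrow> m \<le> c k" by blast
    obtain k where k: "k \<in> T" "k \<ge> K" using T by (metis infinite_nat_iff_unbounded_le)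
    then have "snd (cut (?G k)) = r" "k0 \<le> k" "m \<le> c k" using K cut_T[of k] by simp_all
    then have "m < c (Suc k)" using c_Suc(2)[of k] by simp
    then have "Suc m \<le> c k'" if "Suc k \<le> k'" for k'
      using c_mono[of "Suc k" k'] K(1) k(2) that by simp
    then show ?case using K(1) k(2) by (intro exI[of _ "Suc k"]) simp
  qed auto
  \<comment> \<open>Infinitely many visits to \<open>xs\<close> have cut \<open>r\<close> at the
    same position modulo \<open>length v\<close>, so the distance between two of them is a multiple
    of that length.\<close>
  have "finite ((\<lambda>k. c k mod length v) ` T)"
    by (rule finite_subset[of _ "{..<length v}"]) (use w(2) in auto)
  then obtain k' where "infinite {k \<in> T. c k mod length v = c k' mod length v}"
    using pigeonhole_infinite[OF T] by blast
  then have pick: "\<exists>k \<ge> K. k \<in> T \<and> c k mod length v = c k' mod length v" for K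
    unfolding infinite_nat_iff_unbounded_le by blast
  \<comment> \<open>At \<open>k1\<close> the cut lies beyond \<open>u\<close>. At \<open>k2\<close>
    it has passed position \<open>k1\<close>, so all of \<open>D k1\<close> has been absorbed into
    \<open>B k2\<close>.\<close>
  obtain K1 where K1: "K1 \<ge> k0" "\<And>k. k \<ge> K1 \<Longrightarrow> length u \<le> c k" using unbounded by blast
  obtain k1 where k1: "k1 \<ge> K1" "k1 \<in> T" "c k1 mod length v = c k' mod length v" using pick by blast
  obtain K2 where K2: "K2 \<ge> k0" "\<And>k. k \<ge> K2 \<Longrightarrow> k1 \<le> c k" using unbounded by blast
  obtain k2 where k2: "k2 \<ge> K2" "k2 \<in> T" "c k2 mod length v = c k' mod length v" using pick by blast
  have k01: "k0 \<le> k1" "k0 \<le> k2" using K1(1) k1(1) K2(1) k2(1) by simp_all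
  have lr: "l < r" using cut_bounds(1)[of "?G k1"] G(4)[OF k01(1)] cut_T[OF k1(2)] by simp
  define A where "A = concat (take l (?G k0))"
  define B where "B k = concat (drop l (take r (?G k)))" for k
  define D where "D k = concat (drop r (?G k))" for k
  have "l \<le> r" using lr by simp
  have take_r: "concat (take r (?G k)) = A @ B k" if "k0 \<le> k" for k
  proof -
    have "take r (?G k) = take l (?G k) @ drop l (take r (?G k))"
      using \<open>l \<le> r\<close> by (metis append_take_drop_id min.absorb1 take_take)
    then show ?thesis using base[OF that lr] by (metis A_def B_def concat_append)
  qed
  have split: "map w [0..<k] = A @ B k @ D k" if "k0 \<le> k" for k
    using take_r[OF that] factors_props(1)[of w k]
    by (metis D_def append_assoc append_take_drop_id concat_append)
  have prefix_c: "map w [0..<c k] = A @ B k" if "k0 \<le> k" for k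
  proof -
    have "c k = length (A @ B k)" using take_r[OF that] by (simp add: c_def)
    moreover have "take (length (A @ B k)) (map w [0..<k]) = A @ B k" by (simp add: split[OF that])
    moreover have "length (A @ B k) \<le> k" using arg_cong[OF split[OF that], of length] by simp
    ultimately show ?thesis by (simp add: take_map)
  qed
  have r_len: "r < length (?G k1)" using G(3)[OF k01(1)] cut_T[OF k1(2)] by simp
  have D: "D k1 \<noteq> []"
    using Cons_nth_drop_Suc[OF r_len, symmetric] factors_props(3)[of w k1] nth_mem[OF r_len]
    by (auto simp: D_def)
  have merge: "h (B k1 @ D k1) = h (D k1)"
  proof -
    have "drop l (?G k1) = drop l (take r (?G k1)) @ drop r (?G k1)"
      using \<open>l \<le> r\<close> r_len drop_append[of l "take r (?G k1)" "drop r (?G k1)"] by simp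
    then show ?thesis
      using cut_bounds(3)[of "?G k1"] G(4)[OF k01(1)] cut_T[OF k1(2)] by (simp add: B_def D_def)
  qed
  define E where "E = map w [k1..<c k2]"
  define Y where "Y = D k1 @ E"
  have "A @ B k2 = A @ B k1 @ D k1 @ E"
  proof -
    have "map w [0..<c k2] = map w [0..<k1] @ E"
      using K2(2)[OF k2(1)] upt_add_eq_append[of 0 k1 "c k2 - k1"] by (simp add: E_def flip: map_append)
    then show ?thesis using prefix_c[OF k01(2)] split[OF k01(1)] by simp
  qed
  then have B2: "B k2 = B k1 @ Y" by (simp add: Y_def)
  define f where "f = concat (drop l (take r xs))"
  define s where "s = concat (take l xs)"
  have h_f: "h (B k) = h f" if "k \<in> T" for k
  proof -
    have "[] \<notin> set (drop l (take r (?G k)))"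
      using factors_props(3) by (metis in_set_dropD in_set_takeD)
    then have "h (concat (map rep (drop l (take r (?G k))))) = h (B k)"
      unfolding B_def by (rule h_concat_rep)
    moreover have "map rep (drop l (take r (?G k))) = drop l (take r xs)"
      using that by (auto simp: T_def drop_map take_map)
    ultimately show ?thesis by (simp add: f_def)
  qed
  have h_s: "h A = h s"
  proof -
    have "[] \<notin> set (take l (?G k1))"
      using factors_props(3) by (metis in_set_takeD)
    then have "h (concat (map rep (take l (?G k1)))) = h (concat (take l (?G k1)))"
      by (rule h_concat_rep)
    moreover have "map rep (take l (?G k1)) = take l xs"
      using k1(2) by (auto simp: T_def take_map)
    ultimately show ?thesis using base[OF k01(1) lr] by (simp add: s_def A_def)
  qed
  \<comment> \<open>By \<open>merge\<close>, \<open>B k1\<close> may be put in front of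
    \<open>D k1\<close> without changing the class. This turns \<open>Y\<close> into
    \<open>B k2\<close>, whose class at a visit to \<open>xs\<close> is that of
    \<open>f\<close>.\<close>
  have h_Y: "h Y = h f"
  proof -
    have "h (D k1 @ E) = h ((B k1 @ D k1) @ E)" using merge by (intro append_cong) simp_all
    then show ?thesis using h_f[OF k2(2)] B2 by (simp add: Y_def)
  qed
  have ff: "h (f @ f) = h f"
    using append_cong[OF h_f[OF k1(2)] h_Y] h_f[OF k2(2)] B2 by simp
  have Y: "Y \<noteq> []" using D by (simp add: Y_def)
  have f: "f \<noteq> []"
  proof -
    have "drop l (take r xs) \<noteq> []"
      using lr G(3)[OF k01(1)] cut_T[OF k1(2)] k1(2) by (auto simp: T_def)
    moreover have "rep x \<noteq> []" if "x \<in> set (?G k1)" for x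
      using that factors_props(3)[of w k1] rep[of x] by (cases "x = []") auto
    then have "[] \<notin> rep ` set (?G k1)" by (metis imageE)
    then have "[] \<notin> set xs" using k1(2) by (auto simp: T_def)
    then have "[] \<notin> set (drop l (take r xs))" by (metis in_set_dropD in_set_takeD)
    ultimately show ?thesis unfolding f_def by (cases "drop l (take r xs)") auto
  qed
  have P: "Omega_Words_Fun.prefix (c k1) w = A @ B k1" "Omega_Words_Fun.prefix (c k2) w = (A @ B k1) @ Y"
    by (simp_all only: subsequence_def prefix_c[OF k01(1)] prefix_c[OF k01(2)] B2 append_assoc)
  have pre1: "w = (A @ B k1) \<frown> suffix (c k1) w"
    by (subst P(1)[symmetric]) (rule prefix_suffix)
  have pre2: "w = ((A @ B k1) @ Y) \<frown> suffix (c k2) w"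
    by (subst P(2)[symmetric]) (rule prefix_suffix)
  have c_eq: "c k1 = length (A @ B k1)" "c k2 = c k1 + length Y"
    using take_r[OF k01(1)] take_r[OF k01(2)] B2 by (simp_all add: c_def)
  have "(c k1 + length Y) mod length v = c k1 mod length v" using k1(3) k2(3) c_eq(2) by metis
  then have "length v dvd length Y"
    using mod_eq_dvd_iff_nat[of "c k1" "c k1 + length Y" "length v"] by simp
  moreover have "length u \<le> length (A @ B k1)"
    using K1(2)[OF k1(1)] c_eq(1) by simp
  ultimately have w_eq: "w = (A @ B k1) \<frown> Y\<^sup>\<omega>"
    using ultimately_periodic_split[OF w pre1 pre2] Y by blast
  \<comment> \<open>The table tests the pair of \<open>s\<close> and \<open>f\<close>. The linked
    pair congruent to that of \<open>A @ B k1\<close> and \<open>Y\<close> is formed by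
    \<open>s @ f\<close> and \<open>f\<close>, and it denotes the same word.\<close>
  have "w \<in> W \<longleftrightarrow> (s @ f) \<frown> f\<^sup>\<omega> \<in> W"
  proof -
    have sf: "h (A @ B k1) = h (s @ f)" using h_s h_f[OF k1(2)] by (rule append_cong)
    moreover have "h (Y @ Y) = h Y" using append_cong[OF h_Y h_Y] ff h_Y by simp
    moreover have "h ((A @ B k1) @ Y) = h (A @ B k1)"
      using append_cong[OF sf h_Y] append_cong[OF refl ff, of s] sf by simp
    ultimately show ?thesis
      using W h_Y Y f w_eq unfolding recognizes_def by metis
  qed
  moreover have "(s @ f) \<frown> f\<^sup>\<omega> = s \<frown> f\<^sup>\<omega>"
    using f iter_unroll[of f] by (simp flip: conc_conc)
  ultimately show "concat (take (fst (cut xs)) xs) \<frown>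
      (concat (drop (fst (cut xs)) (take (snd (cut xs)) xs)))\<^sup>\<omega> \<in> W \<longleftrightarrow> w \<in> W"
    by (simp add: s_def f_def l_def r_def)
qed

text \<open>All recurrent states with the least cut give the same verdict, so it does not matter
  which of them witnesses membership in \<open>table\<close>.\<close>

lemma factorization_dma_correct:
  assumes W: "recognizes W"
    and w: "ultimately_periodic w"
  shows "w \<in> dma_lang (factorization_dma W) \<longleftrightarrow> w \<in> W"
proof -
  let ?I = "limit (run (factorization_dma W) w)"
  obtain u v where uv: "w = u \<frown> v\<^sup>\<omega>" "v \<noteq> []"
    using w by (auto simp: ultimately_periodic_def decomposition_def)
  have wf: "wf_dts (factorization_dma W)" using wf_factorization_dma by (auto simp: wf_dma_def)
  obtain xs where xs: "xs \<in> ?I" "\<And>ys. ys \<in> ?I \<Longrightarrow> snd (cut xs) \<le> snd (cut ys)"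
    using limit_nonempty[OF finite_range_run[OF wf]] ex_has_least_nat[of "\<lambda>xs. xs \<in> ?I" _ "\<lambda>xs. snd (cut xs)"] by metis
  note state = recurrent_state[OF W uv]
  show ?thesis
  proof
    assume "w \<in> dma_lang (factorization_dma W)"
    then obtain ys where "ys \<in> ?I" "\<forall>zs \<in> ?I. snd (cut ys) \<le> snd (cut zs)"
      "concat (take (fst (cut ys)) ys) \<frown> (concat (drop (fst (cut ys)) (take (snd (cut ys)) ys)))\<^sup>\<omega> \<in> W"
      by (auto simp: dma_lang_def factorization_dma_def)
    then show "w \<in> W" using state(2) by blast
  next
    assume "w \<in> W"
    moreover have "?I \<subseteq> {xs. set xs \<subseteq> range rep \<and> length xs \<le> Suc bound}"
      using limit_run_subset[OF wf] by (simp add: factorization_dma_def)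
    ultimately show "w \<in> dma_lang (factorization_dma W)"
      using xs state[OF xs] by (auto simp: dma_lang_def factorization_dma_def)
  qed
qed

end

section \<open>The language of a saturated FDFA\<close>

definition fdfa_words :: "('a, 'q, 'p) fdfa \<Rightarrow> acceptance \<Rightarrow> 'a word set" where
  "fdfa_words F t = {u \<frown> v\<^sup>\<omega> | u v. fdfa_accepts F t u v}"

text \<open>Normalized and duo-normalized acceptance quantify over decompositions and thus depend on
  the word alone; for exact acceptance this is saturation.\<close>

lemma fdfa_accepts_iff_words:
  assumes "saturated F t" "v \<noteq> []"
  shows "fdfa_accepts F t u v \<longleftrightarrow> u \<frown> v\<^sup>\<omega> \<in> fdfa_words F t"
proof
  assume "u \<frown> v\<^sup>\<omega> \<in> fdfa_words F t"
  then obtain u' v' where *: "u \<frown> v\<^sup>\<omega> = u' \<frown> v'\<^sup>\<omega>" "fdfa_accepts F t u' v'"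
    by (auto simp: fdfa_words_def)
  show "fdfa_accepts F t u v"
  proof (cases t)
    case Exact
    have "v' \<noteq> []" using *(2) by (auto simp: fdfa_accepts_def)
    then have "v \<in> dfa_lang (progress_at F u) \<longleftrightarrow> v' \<in> dfa_lang (progress_at F u')"
      using assms ultimately_periodicI[OF assms(2), of u] *(1)
      unfolding saturated_def Exact of_type.simps decomposition_def by metis
    then show ?thesis using * assms by (simp add: fdfa_accepts_def Exact)
  qed (use * assms(2) in \<open>auto simp: fdfa_accepts_def\<close>)
qed (auto simp: fdfa_words_def)

text \<open>A duo-normalized decomposition is of the type used by each of the three acceptances, so
  by saturation it decides membership by itself. This treats the three types uniformly from here
  on.\<close>

lemma fdfa_accepts_duo:
  assumes "saturated F t" "v \<noteq> []" "duo_normalized F u v"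
  shows "fdfa_accepts F t u v \<longleftrightarrow> v \<in> dfa_lang (progress_at F u)"
proof -
  have dec: "decomposition u v (u \<frown> v\<^sup>\<omega>)" using assms(2) by (simp add: decomposition_def)
  have norm: "normalized F u v" using assms(3) by (simp add: duo_normalized_def)
  have sat: "v \<in> dfa_lang (progress_at F u) \<longleftrightarrow> y \<in> dfa_lang (progress_at F x)"
    if "decomposition x y (u \<frown> v\<^sup>\<omega>)" "of_type F t x y" for x y
    using assms(1) ultimately_periodicI[OF assms(2), of u] dec that norm assms(3)
    unfolding saturated_def by (cases t) (metis of_type.simps)+
  show ?thesis
  proof (cases t)
    case Exact
    then show ?thesis using assms(2) by (simp add: fdfa_accepts_def)
  next
    case Normalized
    then show ?thesis
      using assms(2) dec norm sat unfolding fdfa_accepts_def Normalized acceptance.case of_type.simps by blast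
  next
    case Duo_Normalized
    then show ?thesis
      using assms(2,3) dec sat unfolding fdfa_accepts_def Duo_Normalized acceptance.case of_type.simps by blast
  qed
qed

text \<open>Linked pairs are duo-normalized. Congruent prefixes select the same progress automaton,
  and congruent periods reach the same state in it.\<close>

lemma recognizes_fdfa_words:
  assumes F: "wf_fdfa F" "saturated F t"
  shows "finite_congruence.recognizes (fdfa_action F) (fdfa_words F t)"
proof -
  interpret finite_congruence "fdfa_action F" using F(1) by (rule finite_congruence_fdfa_action)
  show ?thesis
    unfolding recognizes_def
  proof (intro allI impI)
    fix x y x' y'
    assume ne: "y \<noteq> []" "y' \<noteq> []" and x: "fdfa_action F x = fdfa_action F x'"
      and y: "fdfa_action F y = fdfa_action F y'"
      and yy: "fdfa_action F (y @ y) = fdfa_action F y"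
      and xy: "fdfa_action F (x @ y) = fdfa_action F x"
    have yy': "fdfa_action F (y' @ y') = fdfa_action F y'"
      and xy': "fdfa_action F (x' @ y') = fdfa_action F x'"
      using append_cong[OF y y] append_cong[OF x y] x y xy yy by simp_all
    have duo: "duo_normalized F v w"
      if "fdfa_action F (w @ w) = fdfa_action F w" "fdfa_action F (v @ w) = fdfa_action F v" for v w
      using fdfa_action_leading[OF F(1) that(2), of "[]"] fdfa_action_progress[OF F(1) that(1), of v "[]"]
      by (simp add: duo_normalized_def normalized_def)
    have "progress_at F x = progress_at F x'"
      using fdfa_action_leading[OF F(1) x, of "[]"] by (simp add: progress_at_def)
    moreover have "reach (progress_at F x) y = reach (progress_at F x) y'"
      using fdfa_action_progress[OF F(1) y, of x "[]"] by simp
    ultimately have "fdfa_accepts F t x y \<longleftrightarrow> fdfa_accepts F t x' y'"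
      using fdfa_accepts_duo[OF F(2) ne(1) duo[OF yy xy]] fdfa_accepts_duo[OF F(2) ne(2) duo[OF yy' xy']]
      by (simp add: dfa_lang_def)
    then show "x \<frown> y\<^sup>\<omega> \<in> fdfa_words F t \<longleftrightarrow> x' \<frown> y'\<^sup>\<omega> \<in> fdfa_words F t"
      using fdfa_accepts_iff_words[OF F(2)] ne by blast
  qed
qed

text \<open>The definite description is justified: the factorisation automaton gives existence and
  \<open>omega_regular_eqI\<close> gives uniqueness.\<close>

lemma fdfa_lang:
  fixes F :: "('a::finite, 'q, 'p) fdfa"
  assumes F: "wf_fdfa F" "saturated F t"
  shows "omega_regular (fdfa_lang F t)"
    "{w \<in> fdfa_lang F t. ultimately_periodic w} = fdfa_words F t"
proof -
  interpret finite_congruence "fdfa_action F" using F(1) by (rule finite_congruence_fdfa_action)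
  let ?M = "factorization_dma (fdfa_words F t)"
  let ?P = "\<lambda>L. omega_regular L \<and> {w \<in> L. ultimately_periodic w} = fdfa_words F t"
  have "ultimately_periodic w" if "w \<in> fdfa_words F t" for w
    using that by (auto simp: fdfa_words_def fdfa_accepts_def intro: ultimately_periodicI)
  then have "?P (dma_lang ?M)"
    using factorization_dma_correct[OF recognizes_fdfa_words[OF F]]
      omega_regular_dma_lang[OF wf_factorization_dma] by blast
  then have "\<exists>!L. ?P L" using omega_regular_eqI by metis
  then have "?P (THE L. ?P L)" by (rule theI')
  then show "omega_regular (fdfa_lang F t)"
    "{w \<in> fdfa_lang F t. ultimately_periodic w} = fdfa_words F t"
    by (simp_all add: fdfa_lang_def fdfa_words_def)
qed

lemma fdfa_accepts_iff_lang:
  fixes F :: "('a::finite, 'q, 'p) fdfa"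
  assumes "wf_fdfa F" "saturated F t" "v \<noteq> []"
  shows "fdfa_accepts F t u v \<longleftrightarrow> u \<frown> v\<^sup>\<omega> \<in> fdfa_lang F t"
  using fdfa_accepts_iff_words[OF assms(2,3)] fdfa_lang(2)[OF assms(1,2)] ultimately_periodicI[OF assms(3), of u]
  by blast

section \<open>From inclusion chains to persistent chains\<close>

text \<open>For each state of \<open>S\<close> there is a loop at \<open>p\<close> inside
  \<open>S\<close> that visits it. The component is finite, so concatenating these loops covers
  it.\<close>

lemma scc_loop:
  assumes A: "wf_dts A" and S: "scc A S" "p \<in> S"
  obtains x where "x \<noteq> []" "foldl (step A) p x = p" "set (trace (step A) p x) = S"
proof -
  let ?R = "{(r, step A r a) | r a. r \<in> S \<and> step A r a \<in> S}"
  have path: "\<exists>x. x \<noteq> [] \<and> foldl (step A) q x = q' \<and> set (trace (step A) q x) \<subseteq> S"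
    if "(q, q') \<in> ?R\<^sup>+" for q q'
    using that
  proof (induction rule: trancl_induct)
    case (base q')
    then obtain a where "q' = step A q a" "q \<in> S" by auto
    then show ?case by (intro exI[of _ "[a]"]) simp
  next
    case (step q' q'')
    then obtain a x where "q'' = dts.step A q' a" "q' \<in> S" "x \<noteq> []" "foldl (dts.step A) q x = q'"
      "set (trace (dts.step A) q x) \<subseteq> S" by auto
    then show ?case by (intro exI[of _ "x @ [a]"]) (simp add: trace_append)
  qed
  have path: "\<exists>x. x \<noteq> [] \<and> foldl (step A) q x = q' \<and> set (trace (step A) q x) \<subseteq> S"
    if "q \<in> S" "q' \<in> S" for q q'
    using path S(1) that unfolding scc_def by blast
  have loop: "\<exists>x. x \<noteq> [] \<and> foldl (step A) p x = p \<and> set (trace (step A) p x) \<subseteq> S \<and> q \<in> set (trace (step A) p x)"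
    if q: "q \<in> S" for q
  proof -
    obtain x where x: "foldl (step A) p x = q" "set (trace (step A) p x) \<subseteq> S"
      using path[OF S(2) q] by blast
    obtain y where y: "y \<noteq> []" "foldl (step A) q y = p" "set (trace (step A) q y) \<subseteq> S"
      using path[OF q S(2)] by blast
    \<comment> \<open>The trace of \<open>x\<close> omits its end state \<open>q\<close>, but the
      nonempty way back starts there.\<close>
    have "q \<in> set (trace (step A) q y)" using y(1) by (cases y) simp_all
    then show ?thesis using x y by (intro exI[of _ "x @ y"]) (simp add: trace_append)
  qed
  have "finite S" using A S(1) by (auto simp: wf_dts_def scc_def intro: finite_subset)
  moreover have "finite T \<Longrightarrow> T \<subseteq> S \<Longrightarrow> \<exists>x. x \<noteq> [] \<and> foldl (step A) p x = p \<and>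
      set (trace (step A) p x) \<subseteq> S \<and> T \<subseteq> set (trace (step A) p x)" for T
  proof (induction T rule: finite_induct)
    case empty
    then show ?case using loop[OF S(2)] by blast
  next
    case (insert q T)
    then obtain x where x: "x \<noteq> []" "foldl (step A) p x = p" "set (trace (step A) p x) \<subseteq> S"
      "T \<subseteq> set (trace (step A) p x)" by blast
    obtain y where "foldl (step A) p y = p" "set (trace (step A) p y) \<subseteq> S" "q \<in> set (trace (step A) p y)"
      using loop insert.prems by blast
    then show ?case using x by (intro exI[of _ "x @ y"]) (auto simp: trace_append)
  qed
  ultimately have "\<exists>x. x \<noteq> [] \<and> foldl (step A) p x = p \<and>
      set (trace (step A) p x) \<subseteq> S \<and> S \<subseteq> set (trace (step A) p x)" by blast
  then show ?thesis using that by blast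
qed

text \<open>The append rule for \<open>successively\<close> suits the inductions below, which extend
  chains at the end.\<close>

lemma inclusion_chain_successively:
  "inclusion_chain M Ss \<longleftrightarrow> (\<forall>S \<in> set Ss. reachable_scc M S)
     \<and> successively (\<lambda>S T. S \<subset> T \<and> (T \<in> table M \<longleftrightarrow> S \<notin> table M)) Ss"
  by (simp add: inclusion_chain_def successively_conv_nth)

lemma persistent_chain_successively:
  "persistent_chain F t u vs \<longleftrightarrow> (\<forall>v \<in> set vs. persistent F u v)
     \<and> successively (\<lambda>v w. strict_prefix v w \<and> (fdfa_accepts F t u w \<longleftrightarrow> \<not> fdfa_accepts F t u v)) vs"
  by (simp add: persistent_chain_def successively_conv_nth)

text \<open>Each word of the chain is \<open>w = (v x v)\<^sup>n\<close> for the previous word \<open>v\<close> and a loop \<open>x\<close> through the next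
  component. Ending in \<open>v\<close> makes \<open>w\<close> absorb \<open>v\<close> on the right, so that after the last word all words
  of the chain loop in the leading automaton.\<close>

lemma (in finite_congruence) inclusion_chain_words:
  assumes M: "wf_dma M"
  shows "inclusion_chain M Ss \<Longrightarrow> Ss \<noteq> [] \<Longrightarrow> p \<in> hd Ss \<Longrightarrow>
    \<exists>vs. list_all2 (\<lambda>v S. v \<noteq> [] \<and> h (v @ v) = h v \<and> foldl (step M) p v = p \<and>
        set (trace (step M) p v) = S) vs Ss \<and>
      (\<forall>v \<in> set vs. h (last vs @ v) = h (last vs)) \<and> successively strict_prefix vs"
proof (induction Ss rule: rev_induct)
  case (snoc S Ss)
  have wf: "wf_dts M" using M by (simp add: wf_dma_def)
  have S: "scc M S" using snoc.prems(1) by (simp add: inclusion_chain_def reachable_scc_def)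
  show ?case
  proof (cases "Ss = []")
    case True
    then have "p \<in> S" using snoc.prems(3) by simp
    then obtain x where x: "x \<noteq> []" "foldl (step M) p x = p" "set (trace (step M) p x) = S"
      using scc_loop[OF wf S] by metis
    obtain n where n: "n \<ge> 1" "h (pow n x @ pow n x) = h (pow n x)" using idempotent_pow by blast
    show ?thesis
      by (rule exI[of _ "[pow n x]"])
        (use n x True foldl_pow_fixed[OF x(2)] set_trace_pow[OF x(2) n(1)] in \<open>simp add: pow_eq_Nil\<close>)
  next
    case False
    have chain: "inclusion_chain M Ss" "last Ss \<subset> S"
      using snoc.prems(1) False by (auto simp: inclusion_chain_successively successively_append_iff)
    obtain vs where vs: "list_all2 (\<lambda>v S. v \<noteq> [] \<and> h (v @ v) = h v \<and> foldl (step M) p v = p \<and>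
        set (trace (step M) p v) = S) vs Ss" "\<forall>v \<in> set vs. h (last vs @ v) = h (last vs)" "successively strict_prefix vs"
      using snoc.IH[OF chain(1) False] snoc.prems(3) False by auto
    have vs_ne: "vs \<noteq> []" using vs(1) False by auto
    define v where "v = last vs"
    have v: "v \<noteq> []" "foldl (step M) p v = p" "set (trace (step M) p v) = last Ss"
      using vs(1) vs_ne False list_all2_lengthD[OF vs(1)] unfolding v_def
      by (auto simp: last_conv_nth list_all2_conv_all_nth)
    have "p \<in> set (trace (step M) p v)" using v(1) by (cases v) simp_all
    then have "p \<in> S" using v(3) chain(2) by blast
    then obtain x where x: "x \<noteq> []" "foldl (step M) p x = p" "set (trace (step M) p x) = S"
      using scc_loop[OF wf S] by metis
    \<comment> \<open>Both copies of \<open>v\<close> stay inside \<open>last Ss\<close>, so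
      \<open>y\<close> still visits exactly \<open>S\<close>. The first copy makes \<open>v\<close>
      a prefix, the second provides the absorption.\<close>
    define y where "y = v @ x @ v"
    have y: "y \<noteq> []" "foldl (step M) p y = p" "set (trace (step M) p y) = S"
      using v x chain(2) by (auto simp: y_def trace_append)
    obtain n where n: "n \<ge> 1" "h (pow n y @ pow n y) = h (pow n y)" using idempotent_pow by blast
    then obtain m where m: "n = Suc m" by (cases n) auto
    have "h (pow n y @ z) = h (pow n y)" if "z \<in> set vs" for z
    proof -
      have "h ((pow m y @ v @ x) @ v @ z) = h ((pow m y @ v @ x) @ v)"
        using vs(2) that by (intro append_cong) (simp_all add: v_def)
      then show ?thesis unfolding m pow_Suc_right by (simp add: y_def)
    qed
    moreover have "strict_prefix v (pow n y)"
      using x(1) by (auto simp: m y_def strict_prefix_def)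
    then have "successively strict_prefix (vs @ [pow n y])"
      using vs(3) by (simp add: successively_append_iff v_def)
    moreover have "list_all2 (\<lambda>v S. v \<noteq> [] \<and> h (v @ v) = h v \<and> foldl (step M) p v = p \<and>
        set (trace (step M) p v) = S) (vs @ [pow n y]) (Ss @ [S])"
      by (intro list_all2_appendI vs(1))
        (use n y foldl_pow_fixed[OF y(2)] set_trace_pow[OF y(2) n(1)] in \<open>simp add: pow_eq_Nil\<close>)
    ultimately show ?thesis using n(2) by (intro exI[of _ "vs @ [pow n y]"]) auto
  qed
qed simp

lemma persistent_chain_if_inclusion_chain:
  fixes F :: "('a::finite, 'q, 'p) fdfa" and M :: "('a, 's) dma"
  assumes F: "wf_fdfa F" "saturated F t"
    and M: "wf_dma M" "dma_lang M = fdfa_lang F t"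
    and Ss: "inclusion_chain M Ss" "Ss \<noteq> []"
  obtains u vs where "length vs = length Ss" "persistent_chain F t u vs"
    "fdfa_accepts F t u (hd vs) \<longleftrightarrow> hd Ss \<in> table M"
proof -
  interpret finite_congruence "fdfa_action F" using F(1) by (rule finite_congruence_fdfa_action)
  have "reachable_scc M (hd Ss)" using Ss by (simp add: inclusion_chain_def)
  then obtain p u0 where p: "p \<in> hd Ss" "p = reach M u0" by (fastforce simp: reachable_scc_def scc_def)
  obtain vs where vs: "list_all2 (\<lambda>v S. v \<noteq> [] \<and> fdfa_action F (v @ v) = fdfa_action F v
      \<and> foldl (step M) p v = p \<and> set (trace (step M) p v) = S) vs Ss"
    "\<forall>v \<in> set vs. fdfa_action F (last vs @ v) = fdfa_action F (last vs)" "successively strict_prefix vs"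
    using inclusion_chain_words[OF M(1) Ss p(1)] by (elim exE conjE) (rule that)
  have len: "length vs = length Ss" using vs(1) by (rule list_all2_lengthD)
  have nth: "vs ! i \<noteq> []" "fdfa_action F (vs ! i @ vs ! i) = fdfa_action F (vs ! i)"
    "foldl (step M) p (vs ! i) = p" "set (trace (step M) p (vs ! i)) = Ss ! i" if "i < length vs" for i
    using vs(1) that by (auto simp: list_all2_conv_all_nth)
  have vs_ne: "vs \<noteq> []" using len Ss(2) by auto
  \<comment> \<open>Reading \<open>last vs\<close> keeps \<open>M\<close> in \<open>p\<close>. Since
    it absorbs every word of the chain, all of them become loops of the leading automaton after
    \<open>u\<close>.\<close>
  define u where "u = u0 @ last vs"
  have "foldl (step M) p (last vs) = p" using nth(3) vs_ne by (simp add: last_conv_nth)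
  then have u: "reach M u = p" using p(2) by (simp add: u_def reach_append)
  have accepts: "fdfa_accepts F t u (vs ! i) \<longleftrightarrow> Ss ! i \<in> table M" if i: "i < length vs" for i
  proof -
    have "u \<frown> (vs ! i)\<^sup>\<omega> \<in> dma_lang M \<longleftrightarrow> Ss ! i \<in> table M"
      using limit_run_loop[of "vs ! i" M u] nth[OF i] u by (simp add: dma_lang_def)
    then show ?thesis using fdfa_accepts_iff_lang[OF F nth(1)[OF i]] M(2) by simp
  qed
  \<comment> \<open>Idempotence for the congruence is persistence with exponent 2.\<close>
  have "persistent F u v" if v: "v \<in> set vs" for v
  proof -
    have ne: "v \<noteq> []" and idem: "fdfa_action F (v @ v) = fdfa_action F v"
      using nth v by (metis in_set_conv_nth)+
    have "normalized F u v"
      using fdfa_action_leading[OF F(1), of "last vs @ v" "last vs" u0] vs(2) v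
      by (simp add: normalized_def u_def)
    moreover have "reach (progress_at F u) (z @ v @ v) = reach (progress_at F u) (z @ v)" for z
      using fdfa_action_progress[OF F(1) idem] .
    ultimately show ?thesis
      using ne \<open>\<And>z. reach (progress_at F u) (z @ v @ v) = reach (progress_at F u) (z @ v)\<close>[of "[]"]
      unfolding persistent_def duo_normalized_def
      by (auto intro!: exI[of _ 2] simp: numeral_2_eq_2)
  qed
  moreover have "strict_prefix (vs ! i) (vs ! Suc i) \<and>
      (fdfa_accepts F t u (vs ! Suc i) \<longleftrightarrow> \<not> fdfa_accepts F t u (vs ! i))" if "Suc i < length vs" for i
    using that vs(3) Ss(1) accepts len by (auto simp: successively_conv_nth inclusion_chain_def)
  ultimately have "persistent_chain F t u vs" by (simp add: persistent_chain_def)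
  then show ?thesis
    using that[OF len] accepts[of 0] vs_ne Ss(2) by (simp add: hd_conv_nth)
qed

section \<open>From persistent chains to inclusion chains\<close>

lemma reachable_scc_limit:
  assumes A: "wf_dts A"
  shows "reachable_scc A (limit (run A w))"
proof -
  let ?r = "run A w" and ?S = "limit (run A w)"
  let ?R = "{(r, step A r a) | r a. r \<in> ?S \<and> step A r a \<in> ?S}"
  have fin: "finite (range ?r)" using A by (rule finite_range_run)
  obtain k where "?S = range (suffix k ?r)" using limit_is_suffix[OF fin] by blast
  then have k: "?r i \<in> ?S" if "k \<le> i" for i
    using that by (metis le_add_diff_inverse rangeI suffix_nth)
  have Suc: "?r (Suc i) = step A (?r i) (w i)" for i
    by (simp add: run_def reach_append)
  have path: "(?r i, ?r (Suc (i + d))) \<in> ?R\<^sup>+" if "k \<le> i" for i d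
  proof (induction d)
    case 0
    have "(?r i, ?r (Suc i)) \<in> ?R" using k[of i] k[of "Suc i"] that Suc[of i] by auto
    then show ?case by auto
  next
    case (Suc d)
    have "(?r (Suc (i + d)), ?r (Suc (Suc (i + d)))) \<in> ?R"
      using k[of "Suc (i + d)"] k[of "Suc (Suc (i + d))"] that \<open>\<And>i. ?r (Suc i) = step A (?r i) (w i)\<close>[of "Suc (i + d)"] by auto
    then show ?case using Suc by (simp add: trancl.trancl_into_trancl)
  qed
  have "(p, q) \<in> ?R\<^sup>+" if pq: "p \<in> ?S" "q \<in> ?S" for p q
  proof -
    obtain i where i: "k \<le> i" "?r i = p" using pq(1) by (auto simp: limit_iff_frequent INFM_nat_le)
    obtain j where j: "Suc i \<le> j" "?r j = q" using pq(2) by (auto simp: limit_iff_frequent INFM_nat_le)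
    then show ?thesis using path[OF i(1), of "j - Suc i"] i(2) by simp
  qed
  moreover have "?S \<noteq> {}" using limit_nonempty[OF fin] by blast
  moreover have "?S \<subseteq> range (reach A)" using limit_in_range by (fastforce simp: run_def)
  ultimately show ?thesis
    using limit_run_subset[OF A] by (simp add: reachable_scc_def scc_def)
qed

text \<open>\<open>w\<close> itself need not be a loop of \<open>A\<close> after \<open>x\<close>;
  the block \<open>pow n w\<close> is one once it has been read.\<close>

lemma limit_run_omega:
  assumes "w \<noteq> []" "n \<ge> 1" "reach A (x @ pow n w @ pow n w) = reach A (x @ pow n w)"
  shows "limit (run A (x \<frown> w\<^sup>\<omega>)) = set (trace (step A) (reach A (x @ pow n w)) (pow n w))"
proof -
  have "x \<frown> w\<^sup>\<omega> = (x @ pow n w) \<frown> (pow n w)\<^sup>\<omega>"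
    using omega_pow[OF assms(2,1)] pow_conc_omega[OF assms(1)] by (simp flip: conc_conc)
  then show ?thesis
    using limit_run_loop[of "pow n w" A "x @ pow n w"] assms by (simp add: pow_eq_Nil reach_append)
qed

lemma (in finite_congruence) idempotent_pow_pow:
  assumes "h (v @ v) = h v" "j \<ge> 1"
  shows "h (pow j v) = h v"
  using assms(2)
proof (induction j rule: dec_induct)
  case (step j)
  have "h (v @ pow j v) = h (v @ v)" using step.IH by (intro append_cong) simp_all
  then show ?case using assms(1) by simp
qed simp

text \<open>Persistence of \<open>v\<close> is what allows \<open>v\<close> to be pumped inside its extensions: every reachable
  state enters a \<open>v\<close>-cycle with the first \<open>v\<close>, so \<open>2n + 1\<close> copies act like one.\<close>

lemma pump_persistent:
  assumes F: "wf_fdfa F" and v: "persistent F u v"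
    and w: "\<And>z. reach (progress_at F u) (z @ w) = reach (progress_at F u) (z @ v)"
    and n: "fdfa_action F (pow n w @ pow n w) = fdfa_action F (pow n w)"
  shows "reach (progress_at F u) (z @ pow (2 * n + 1) w) = reach (progress_at F u) (z @ v)"
proof -
  interpret finite_congruence "fdfa_action F" using F by (rule finite_congruence_fdfa_action)
  let ?P = "progress_at F u"
  have pow_w: "reach ?P (z @ pow j w) = reach ?P (z @ pow j v)" for j
  proof (induction j)
    case (Suc j)
    then show ?case
      using w[of "z @ pow j w"] by (simp only: pow_Suc_right flip: append_assoc) (simp add: reach_append)
  qed simp
  obtain i where i: "i \<ge> 2" "reach ?P (z @ v) = reach ?P (z @ pow i v)"
    using v by (auto simp: persistent_def)
  then obtain m where m: "i = Suc m" "m \<ge> 1" by (cases i) auto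
  have "foldl (step ?P) (reach ?P (z @ w)) (pow m w) = reach ?P (z @ w)"
    using w i(2) pow_w[of i] by (simp add: m reach_append)
  then have "foldl (step ?P) (reach ?P (z @ w)) (pow n (pow m w)) = reach ?P (z @ w)"
    by (rule foldl_pow_fixed)
  \<comment> \<open>Persistence yields a return after \<open>m\<close> copies of \<open>w\<close>.
    Exchanging the exponents and using that \<open>pow n w\<close> is idempotent turns it into a
    return after \<open>n\<close> copies.\<close>
  moreover have "pow n (pow m w) = pow m (pow n w)"
    by (metis pow_mult mult.commute)
  ultimately have "reach ?P ((z @ w) @ pow m (pow n w)) = reach ?P (z @ w)"
    by (simp add: reach_append)
  then have "reach ?P ((z @ w) @ pow n w) = reach ?P (z @ w)"
    using fdfa_action_progress[OF F idempotent_pow_pow[OF n m(2)], of u "z @ w"] by simp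
  then have "reach ?P (z @ w @ pow n w @ pow n w) = reach ?P (z @ w)"
    by (simp add: reach_append)
  moreover have "pow (2 * n + 1) w = w @ pow n w @ pow n w"
    using pow_add[of n n w] by (simp add: mult_2)
  ultimately show ?thesis using w by simp
qed

text \<open>A word acting like \<open>v\<close> on the progress automaton reaches the same state as
  \<open>v\<close> and is again duo-normalized. So it inherits the verdict on \<open>v\<close> after
  any prefix with the same leading state.\<close>

lemma limit_run_persistent:
  fixes F :: "('a::finite, 'q, 'p) fdfa" and M :: "('a, 's) dma"
  assumes F: "wf_fdfa F" "saturated F t"
    and M: "dma_lang M = fdfa_lang F t"
    and v: "persistent F u v"
    and w: "w \<noteq> []" "reach (leading F) (u @ w) = reach (leading F) u"
      "\<And>z. reach (progress_at F u) (z @ w) = reach (progress_at F u) (z @ v)"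
    and x: "reach (leading F) x = reach (leading F) u"
  shows "limit (run M (x \<frown> w\<^sup>\<omega>)) \<in> table M \<longleftrightarrow> fdfa_accepts F t u v"
proof -
  have P: "progress_at F x = progress_at F u" using x by (simp add: progress_at_def)
  have v': "v \<noteq> []" "duo_normalized F u v" using v by (simp_all add: persistent_def)
  have "reach (progress_at F u) (w @ w) = reach (progress_at F u) w"
    using w(3)[of w] w(3)[of "[]"] v'(2) by (simp add: duo_normalized_def reach_append)
  then have duo: "duo_normalized F x w"
    using w(2) x P by (simp add: duo_normalized_def normalized_def reach_append)
  have "x \<frown> w\<^sup>\<omega> \<in> dma_lang M \<longleftrightarrow> fdfa_accepts F t x w"
    using fdfa_accepts_iff_lang[OF F w(1)] M by simp
  also have "\<dots> \<longleftrightarrow> w \<in> dfa_lang (progress_at F u)"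
    using fdfa_accepts_duo[OF F(2) w(1) duo] P by simp
  also have "\<dots> \<longleftrightarrow> fdfa_accepts F t u v"
    using fdfa_accepts_duo[OF F(2) v'] w(3)[of "[]"] by (simp add: dfa_lang_def)
  finally show ?thesis by (simp add: dma_lang_def)
qed

text \<open>The word \<open>w\<close> imitates the last word of the chain, but reads it with every earlier word pumped
  long enough for \<open>M\<close> to run through the loop of that earlier word.\<close>

lemma persistent_chain_word:
  fixes F :: "('a::finite, 'q, 'p) fdfa" and M :: "('a, 's) dma"
  assumes F: "wf_fdfa F" "saturated F t"
    and M: "wf_dma M" "dma_lang M = fdfa_lang F t"
  shows "persistent_chain F t u vs \<Longrightarrow> vs \<noteq> [] \<Longrightarrow>
    \<exists>w. w \<noteq> [] \<and> reach (leading F) (u @ w) = reach (leading F) u \<and>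
      (\<forall>z. reach (progress_at F u) (z @ w) = reach (progress_at F u) (z @ last vs)) \<and>
      (\<forall>x. reach (leading F) x = reach (leading F) u \<longrightarrow>
        (\<exists>Ss. inclusion_chain M Ss \<and> list_all2 (\<lambda>S v. S \<in> table M \<longleftrightarrow> fdfa_accepts F t u v) Ss vs \<and>
          last Ss = limit (run M (x \<frown> w\<^sup>\<omega>))))"
proof (induction vs rule: rev_induct)
  case (snoc v' vs)
  let ?Q = "leading F" and ?P = "progress_at F u"
  have wf: "wf_dts M" using M(1) by (simp add: wf_dma_def)
  have v': "persistent F u v'" using snoc.prems(1) by (simp add: persistent_chain_def)
  then have v'_ne: "v' \<noteq> []" and v'_loop: "reach ?Q (u @ v') = reach ?Q u"
    by (simp_all add: persistent_def duo_normalized_def normalized_def)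
  show ?case
  proof (cases "vs = []")
    case True
    have "\<exists>Ss. inclusion_chain M Ss \<and> list_all2 (\<lambda>S v. S \<in> table M \<longleftrightarrow> fdfa_accepts F t u v) Ss [v'] \<and>
          last Ss = limit (run M (x \<frown> v'\<^sup>\<omega>))" if "reach ?Q x = reach ?Q u" for x
      using limit_run_persistent[OF F M(2) v' v'_ne v'_loop refl that] reachable_scc_limit[OF wf]
      by (intro exI[of _ "[limit (run M (x \<frown> v'\<^sup>\<omega>))]"]) (simp add: inclusion_chain_def)
    then show ?thesis using v'_ne v'_loop True by (intro exI[of _ v'] conjI allI impI) (simp_all del: iter_nth)
  next
    case False
    define v where "v = last vs"
    have chain: "persistent_chain F t u vs" "strict_prefix v v'"
      "fdfa_accepts F t u v' \<longleftrightarrow> \<not> fdfa_accepts F t u v"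
      using snoc.prems(1) False by (auto simp: persistent_chain_successively successively_append_iff v_def)
    have v: "persistent F u v" using chain(1) False by (simp add: persistent_chain_def v_def)
    then have v_loop: "reach ?Q (u @ v) = reach ?Q u"
      by (simp add: persistent_def duo_normalized_def normalized_def)
    obtain z where z: "v' = v @ z" using chain(2) by (auto elim: strict_prefixE')
    obtain w where w: "w \<noteq> []" "reach ?Q (u @ w) = reach ?Q u"
      "\<And>y. reach ?P (y @ w) = reach ?P (y @ v)"
      "\<And>x. reach ?Q x = reach ?Q u \<Longrightarrow> \<exists>Ss. inclusion_chain M Ss \<and>
          list_all2 (\<lambda>S v. S \<in> table M \<longleftrightarrow> fdfa_accepts F t u v) Ss vs \<and>
          last Ss = limit (run M (x \<frown> w\<^sup>\<omega>))"
      using snoc.IH[OF chain(1) False] unfolding v_def by blast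
    \<comment> \<open>Pairing the actions of \<open>M\<close> and \<open>F\<close> provides one
      exponent \<open>n\<close> that is idempotent for both.\<close>
    interpret finite_congruence "\<lambda>w. (action M w, fdfa_action F w)"
      using finite_congruence_pair finite_congruence_action[OF wf] finite_congruence_fdfa_action[OF F(1)] by blast
    have idem: "reach M (x @ pow n y @ pow n y) = reach M (x @ pow n y)"
      if "action M (pow n y @ pow n y) = action M (pow n y)" for x n y
      using action_eqD[OF that, of "reach M x"] reach_closed[OF wf] by (simp add: reach_append)
    obtain n where n: "n \<ge> 1" "action M (pow n w @ pow n w) = action M (pow n w)"
      "fdfa_action F (pow n w @ pow n w) = fdfa_action F (pow n w)"
      using idempotent_pow[of w] by auto
    define w' where "w' = pow (2 * n + 1) w @ z"
    have w'_ne: "w' \<noteq> []" using w(1) by (simp add: w'_def)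
    have Qw: "foldl (step ?Q) (reach ?Q u) (pow j w) = reach ?Q u" for j
      using w(2) by (intro foldl_pow_fixed) (simp add: reach_append)
    have w'_loop: "reach ?Q (u @ w') = reach ?Q u"
      using v'_loop v_loop Qw unfolding w'_def z by (simp only: reach_append foldl_append)
    have w'_P: "reach ?P (y @ w') = reach ?P (y @ v')" for y
      using pump_persistent[OF F(1) v w(3) n(3), of y]
      unfolding w'_def z by (simp only: append_assoc[symmetric] reach_append[of _ _ z])
    obtain n' where n': "n' \<ge> 1" "action M (pow n' w' @ pow n' w') = action M (pow n' w')"
      using idempotent_pow[of w'] by auto
    have "\<exists>Ss. inclusion_chain M Ss \<and>
          list_all2 (\<lambda>S v. S \<in> table M \<longleftrightarrow> fdfa_accepts F t u v) Ss (vs @ [v']) \<and>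
          last Ss = limit (run M (x \<frown> w'\<^sup>\<omega>))" if x: "reach ?Q x = reach ?Q u" for x
    proof -
      \<comment> \<open>After \<open>x'\<close> the automaton \<open>M\<close> is on its cycle for
        \<open>pow n' w'\<close>. The induction hypothesis is applied at this later prefix, which is
        why it ranges over all prefixes with the leading state of \<open>u\<close>.\<close>
      define x' where "x' = x @ pow n' w'"
      define S where "S = limit (run M (x \<frown> w'\<^sup>\<omega>))"
      have S: "S = set (trace (step M) (reach M x') (pow n' w'))"
        using limit_run_omega[OF w'_ne n'(1) idem[OF n'(2)]] by (simp add: S_def x'_def)
      have "foldl (step ?Q) (reach ?Q u) (pow n' w') = reach ?Q u"
        using w'_loop by (intro foldl_pow_fixed) (simp add: reach_append)
      then have "reach ?Q x' = reach ?Q u" using x by (simp add: x'_def reach_append)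
      then obtain Ss where Ss: "inclusion_chain M Ss"
        "list_all2 (\<lambda>S v. S \<in> table M \<longleftrightarrow> fdfa_accepts F t u v) Ss vs"
        "last Ss = limit (run M (x' \<frown> w\<^sup>\<omega>))" using w(4) by blast
      have S_table: "S \<in> table M \<longleftrightarrow> fdfa_accepts F t u v'"
        unfolding S_def by (rule limit_run_persistent[OF F M(2) v' w'_ne w'_loop w'_P x])
      have Ss_ne: "Ss \<noteq> []" using Ss(2) False by auto
      have last_table: "last Ss \<in> table M \<longleftrightarrow> fdfa_accepts F t u v"
        using Ss(2) Ss_ne False list_all2_lengthD[OF Ss(2)]
        by (auto simp: v_def last_conv_nth list_all2_conv_all_nth)
      obtain m where m: "n' = Suc m" using n'(1) by (cases n') auto
      \<comment> \<open>The first \<open>pow n w\<close> brings \<open>M\<close> onto its cycle, the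
        second traverses the limit set of the previous word, and the remaining \<open>w\<close>
        makes the pumped block act like \<open>v\<close>.\<close>
      have "pow (2 * n + 1) w = pow n w @ pow n w @ w"
        using pow_add[of n n w] pow_add[of "2 * n" 1 w] by (simp add: mult_2)
      then have "pow n' w' = pow n w @ pow n w @ w @ z @ pow m w'"
        by (simp add: m w'_def)
      then have "last Ss \<subseteq> S"
        unfolding Ss(3) limit_run_omega[OF w(1) n(1) idem[OF n(2)]] S
        by (auto simp: trace_append reach_append)
      \<comment> \<open>Strictness comes from the opposite acceptance of the two sets.\<close>
      then have "last Ss \<subset> S" using S_table last_table chain(3) by blast
      then have "inclusion_chain M (Ss @ [S])"
        using Ss(1) S_table last_table chain(3) reachable_scc_limit[OF wf, of "x \<frown> w'\<^sup>\<omega>"] Ss_ne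
        by (auto simp: inclusion_chain_successively successively_append_iff S_def)
      moreover have "list_all2 (\<lambda>S v. S \<in> table M \<longleftrightarrow> fdfa_accepts F t u v) (Ss @ [S]) (vs @ [v'])"
        using Ss(2) S_table by (intro list_all2_appendI) simp_all
      ultimately show ?thesis by (intro exI[of _ "Ss @ [S]"]) (simp add: S_def del: iter_nth)
    qed
    then show ?thesis using w'_ne w'_loop w'_P by (intro exI[of _ w'] conjI allI impI) (simp_all del: iter_nth)
  qed
qed simp

lemma inclusion_chain_if_persistent_chain:
  fixes F :: "('a::finite, 'q, 'p) fdfa" and M :: "('a, 's) dma"
  assumes F: "wf_fdfa F" "saturated F t"
    and M: "wf_dma M" "dma_lang M = fdfa_lang F t"
    and vs: "persistent_chain F t u vs" "vs \<noteq> []"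
  obtains Ss where "length Ss = length vs" "inclusion_chain M Ss"
    "hd Ss \<in> table M \<longleftrightarrow> fdfa_accepts F t u (hd vs)"
proof -
  obtain Ss where "inclusion_chain M Ss"
    and rel: "list_all2 (\<lambda>S v. S \<in> table M \<longleftrightarrow> fdfa_accepts F t u v) Ss vs"
    using persistent_chain_word[OF F M vs] by blast
  moreover have "hd Ss \<in> table M \<longleftrightarrow> fdfa_accepts F t u (hd vs)"
    using rel vs(2) by (cases rule: list.rel_cases) auto
  ultimately show ?thesis using that list_all2_lengthD by blast
qed

section \<open>Equality of the measures\<close>

lemma dma_fdfa_measures:
  fixes F :: "('a::finite, 'q, 'p) fdfa" and M :: "('a, 's) dma"
  assumes F: "wf_fdfa F" "saturated F t"
    and M: "wf_dma M" "dma_lang M = fdfa_lang F t"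
  shows "dma_pos M = fdfa_pos F t" "dma_neg M = fdfa_neg F t"
proof -
  \<comment> \<open>The Boolean \<open>b\<close> fixes the polarity, so one argument serves both
    measures.\<close>
  have "{enat (length Ss) | Ss. Ss \<noteq> [] \<and> inclusion_chain M Ss \<and> (hd Ss \<in> table M \<longleftrightarrow> b)} =
    {enat (length vs) | u vs. vs \<noteq> [] \<and> persistent_chain F t u vs \<and> (fdfa_accepts F t u (hd vs) \<longleftrightarrow> b)}"
    (is "?A = ?B") for b
  proof
    show "?A \<subseteq> ?B"
    proof
      fix l assume "l \<in> ?A"
      then obtain Ss where Ss: "l = enat (length Ss)" "Ss \<noteq> []" "inclusion_chain M Ss" "hd Ss \<in> table M \<longleftrightarrow> b"
        by blast
      obtain u vs where "length vs = length Ss" "persistent_chain F t u vs"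
        "fdfa_accepts F t u (hd vs) \<longleftrightarrow> hd Ss \<in> table M"
        using persistent_chain_if_inclusion_chain[OF F M Ss(3,2)] .
      moreover from this(1) have "vs \<noteq> []" using Ss(2) by auto
      ultimately show "l \<in> ?B" using Ss by (intro CollectI exI[of _ u] exI[of _ vs]) simp
    qed
    show "?B \<subseteq> ?A"
    proof
      fix l assume "l \<in> ?B"
      then obtain u vs where vs: "l = enat (length vs)" "vs \<noteq> []" "persistent_chain F t u vs"
        "fdfa_accepts F t u (hd vs) \<longleftrightarrow> b"
        by blast
      obtain Ss where "length Ss = length vs" "inclusion_chain M Ss"
        "hd Ss \<in> table M \<longleftrightarrow> fdfa_accepts F t u (hd vs)"
        using inclusion_chain_if_persistent_chain[OF F M vs(3,2)] .
      moreover from this(1) have "Ss \<noteq> []" using vs(2) by auto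
      ultimately show "l \<in> ?A" using vs by (intro CollectI exI[of _ Ss]) simp
    qed
  qed
  from this[of True] this[of False]
  show "dma_pos M = fdfa_pos F t" "dma_neg M = fdfa_neg F t"
    by (simp_all add: dma_pos_def dma_neg_def fdfa_pos_def fdfa_neg_def)
qed

theorem theorem14:
  fixes F :: "('a::finite, 'q, 'p) fdfa" and t :: acceptance and k :: nat
  assumes "wf_fdfa F" and "saturated F t" and "k \<ge> 1"
  shows "(fdfa_lang F t \<in> DM_both k \<longleftrightarrow> fdfa_pos F t \<le> enat k \<and> fdfa_neg F t \<le> enat k)
    \<and> (fdfa_lang F t \<in> DM_pos k \<longleftrightarrow> fdfa_pos F t \<le> enat k \<and> fdfa_neg F t < enat k)
    \<and> (fdfa_lang F t \<in> DM_neg k \<longleftrightarrow> fdfa_pos F t < enat k \<and> fdfa_neg F t \<le> enat k)"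
proof -
  obtain M :: "('a, nat) dma" where M: "wf_dma M" "dma_lang M = fdfa_lang F t"
    using fdfa_lang(1)[OF assms(1,2)] by (auto simp: omega_regular_def)
  note measures = dma_fdfa_measures[OF assms(1,2)]
  \<comment> \<open>All automata of the language have the measures of \<open>F\<close>, so the
    existential reduces to the condition on \<open>F\<close>, with \<open>M\<close> as
    witness.\<close>
  have "(\<exists>N :: ('a, nat) dma. fdfa_lang F t = dma_lang N \<and> wf_dma N \<and> P (dma_pos N) (dma_neg N)) \<longleftrightarrow>
      P (fdfa_pos F t) (fdfa_neg F t)" for P
    using M measures by metis
  from this[of "\<lambda>p n. p \<le> enat k \<and> n \<le> enat k"] this[of "\<lambda>p n. p \<le> enat k \<and> n < enat k"]
    this[of "\<lambda>p n. p < enat k \<and> n \<le> enat k"]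
  show ?thesis by (simp add: DM_both_def DM_pos_def DM_neg_def)
qed

end
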